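(* For every (non-degenerate) triangle $S\subset\mathbb{R}^2$, \[ f(\mathcal{K}^2,\mathcal{K}^2)=f(\mathcal{K}^2,S). \]
   Context: $\mathcal{K}^n$ denotes the set of convex bodies, i.e. (nonempty) convex compact subsets of $\mathbb{R}^n$. For $K,C\in\mathcal{K}^n$, with $C$ full-dimensional (the gauge): the circumradius $R(K,C)$ is the smallest $\lambda\geq 0$ such that a translate of $K$ is contained in $\lambda C$; the inradius $r(K,C)$ is the largest $\lambda\geq 0$ such that a translate of $K$ contains $\lambda C$; the diameter is $D(K,C)=2\max_{x,y\in K}R(\{x,y\},C)$. For $K$ not a single point (so that $R(K,C)>0$), define \[ f(K,C)=\left(\frac{r(K,C)}{R(K,C)},\frac{D(K,C)}{2R(K,C)}\right)\in[0,1]^2 . \] For a fixed full-dimensional $C$, $f(\mathcal{K}^n,C)$ denotes the set of all values $f(K,C)$ with $K\in\mathcal{K}^n$ not a single point, and $f(\mathcal{K}^n,\mathcal{K}^n)$ is the union of the sets $f(\mathcal{K}^n,C)$ over all full-dimensional $C\in\mathcal{K}^n$. *)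

theory Defs
  imports "HOL-Analysis.Analysis"
begin

definition convex_bodies :: "'a::euclidean_space set set" where
  "convex_bodies = {K. K \<noteq> {} \<and> compact K \<and> convex K}"

definition gauges :: "'a::euclidean_space set set" where
  "gauges = {C \<in> convex_bodies. aff_dim C = int DIM('a)}"

text \<open>The extrema below are attained, by compactness, whenever \<open>K\<close> is a nonempty compact set
  and \<open>C\<close> is a gauge, so \<open>LEAST\<close> and \<open>GREATEST\<close> are well-defined there. Gauges need neither be
  symmetric nor contain the origin. \<open>circumradius\<close> is also applied to the two-point
  (not convex) sets \<open>{x, y}\<close>.\<close>

definition circumradius :: "'a::euclidean_space set \<Rightarrow> 'a set \<Rightarrow> real" where
  "circumradius K C =
     (LEAST l::real. 0 \<le> l \<and> (\<exists>t. (\<lambda>x. t + x) ` K \<subseteq> (\<lambda>x. l *\<^sub>R x) ` C))"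

definition inradius :: "'a::euclidean_space set \<Rightarrow> 'a set \<Rightarrow> real" where
  "inradius K C =
     (GREATEST l::real. 0 \<le> l \<and> (\<exists>t. (\<lambda>x. l *\<^sub>R x) ` C \<subseteq> (\<lambda>x. t + x) ` K))"

definition gauge_diameter :: "'a::euclidean_space set \<Rightarrow> 'a set \<Rightarrow> real" where
  "gauge_diameter K C =
     2 * (GREATEST d::real. \<exists>x\<in>K. \<exists>y\<in>K. d = circumradius {x, y} C)"

definition radii_ratios :: "'a::euclidean_space set \<Rightarrow> 'a set \<Rightarrow> real \<times> real" where
  "radii_ratios K C =
     (inradius K C / circumradius K C, gauge_diameter K C / (2 * circumradius K C))"

definition diagram :: "'a::euclidean_space set \<Rightarrow> (real \<times> real) set" where
  "diagram C = {radii_ratios K C | K. K \<in> convex_bodies \<and> \<not> is_singleton K}"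

definition full_diagram :: "'a::euclidean_space itself \<Rightarrow> (real \<times> real) set" where
  "full_diagram _ = (\<Union>C \<in> (gauges :: 'a set set). diagram C)"

end

theory Submission
  imports Defs
begin

text \<open>
  Write \<open>R\<close> for the circumradius, \<open>r\<close> for the inradius and \<open>d\<close> for half the diameter of \<open>K\<close> with
  respect to \<open>C\<close>, and scale so that \<open>R = 1\<close>. Both diagrams are equal to one explicit region,
  \<open>radii_region\<close>, given by \<open>1/2 \<le> d \<le> 1\<close> and \<open>d (1 - d) \<le> r \<le> (3 d - 1) / 2\<close>. Since a triangle is
  itself a gauge, this needs two inclusions: the ratios of every pair \<open>K\<close>, \<open>C\<close> lie in the region, and
  every point of the region comes from a convex body inside the given triangle.

  For the first inclusion, let \<open>K \<subseteq> C\<close> be such that no translate of \<open>K\<close> fits into a smaller copy of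
  \<open>C\<close>. Then there are points \<open>p\<^sub>1, p\<^sub>2, p\<^sub>3\<close> of \<open>K\<close> and vectors \<open>a\<^sub>1, a\<^sub>2, a\<^sub>3\<close> with sum zero, not all of
  them zero, such that \<open>C\<close> attains its maximum in direction \<open>a\<^sub>i\<close> at \<open>p\<^sub>i\<close>
  (\<open>optimal_containment_plane\<close>). Unless \<open>d = 1\<close>, the supporting lines at these points bound a triangle
  \<open>T\<close> that contains \<open>C\<close> and touches \<open>K\<close> with all three edges. The bound \<open>r \<le> (3 d - 1) / 2\<close> comes from
  comparing the widths of \<open>K\<close> and \<open>C\<close> in the three directions (\<open>inradius_diameter_inequality\<close>). For
  the bound \<open>d (1 - d) \<le> r\<close>, the gauge \<open>C\<close> can be replaced by \<open>T\<close>: a copy of \<open>T\<close> inside \<open>K\<close> contains a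
  copy of \<open>C\<close>, while the passage from \<open>C\<close> to the larger set \<open>T\<close> can only decrease \<open>d\<close>. This is why
  triangles are the extreme gauges. If the points
  \<open>p\<^sub>i\<close> divide the edges of \<open>T\<close> in the ratios \<open>x : 1 - x\<close>, \<open>y : 1 - y\<close>, \<open>z : 1 - z\<close>, in cyclic order,
  then their convex hull contains a copy of \<open>T\<close> scaled by \<open>x y z + (1 - x) (1 - y) (1 - z)\<close>
  (\<open>inscribed_copy\<close>), and \<open>x, y, z\<close> lie in the interval from \<open>1 - d\<close> to \<open>d\<close>, which makes this
  multi-affine expression at least \<open>d (1 - d)\<close>.

  For the second inclusion, the given triangle is truncated by three lines, described by linear
  inequalities between barycentric coordinates. For these truncated triangles all three radii can be computed
  exactly (\<open>truncated_triangle_realises\<close>), and their two parameters sweep out the whole region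
  (\<open>region_subset_diagram\<close>).
\<close>

section \<open>Attainment of the circumradius, the inradius and the diameter\<close>

lemma gauge_contains_ball:
  fixes C :: "'a::euclidean_space set"
  assumes "C \<in> gauges"
  obtains c e where "e > 0" "cball c e \<subseteq> C"
proof -
  have C: "convex C" "aff_dim C = int DIM('a)" "C \<noteq> {}"
    using assms by (auto simp: gauges_def convex_bodies_def)
  then have "affine hull C = UNIV" by (simp add: aff_dim_eq_full)
  then have "interior C \<noteq> {}"
    using C rel_interior_interior rel_interior_eq_empty by metis
  then show thesis using that by (meson ex_in_conv mem_interior_cball)
qed

lemma closed_subset_compact:
  fixes P Q :: "'a::t2_space set"
  assumes "closed P" "P \<subseteq> Q" "compact Q"
  shows "compact P"
  using compact_Int_closed[OF assms(3,1)] assms(2) by (simp add: inf_absorb2)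

lemma scaled_cball:
  fixes C :: "'a::real_normed_vector set"
  assumes "cball c e \<subseteq> C" "e > 0" "l \<ge> 0" "norm x \<le> l * e"
  obtains c' where "c' \<in> C" "x = l *\<^sub>R (c' - c)"
proof (cases "l = 0")
  case True
  moreover have "c \<in> C" using assms by auto
  ultimately show thesis using assms that[of c] by auto
next
  case False
  have "c + (1/l) *\<^sub>R x \<in> cball c e"
    using assms False by (simp add: dist_norm field_simps)
  with assms False show thesis using that[of "c + (1/l) *\<^sub>R x"] by auto
qed

text \<open>
  The admissible pairs of a ratio and a translation vector, with the ratio bounded by that of one
  fixed containment, form a compact set, so the ratio attains its minimum on it. The ball inside the
  gauge provides the fixed containment.
\<close>

lemma circumradius_least:
  fixes K C :: "'a::euclidean_space set"
  assumes K: "compact K" "K \<noteq> {}" and C: "C \<in> gauges"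
  shows "0 \<le> circumradius K C \<and> (\<exists>t. (\<lambda>x. t + x) ` K \<subseteq> (\<lambda>x. circumradius K C *\<^sub>R x) ` C)"
    and "\<And>l t. 0 \<le> l \<Longrightarrow> (\<lambda>x. t + x) ` K \<subseteq> (\<lambda>x. l *\<^sub>R x) ` C \<Longrightarrow> circumradius K C \<le> l"
proof -
  let ?F = "\<lambda>l. 0 \<le> l \<and> (\<exists>t. (\<lambda>x. t + x) ` K \<subseteq> (\<lambda>x. l *\<^sub>R x) ` C)"
  have cC: "compact C" using C by (auto simp: gauges_def convex_bodies_def)
  obtain c e where e: "e > 0" "cball c e \<subseteq> C" using gauge_contains_ball[OF C] .
  obtain B where B: "B > 0" "\<And>x. x \<in> K \<Longrightarrow> norm x \<le> B"
    using K compact_imp_bounded bounded_pos by metis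
  define M where "M = B / e"
  have M: "M \<ge> 0" "M * e = B" using B e by (auto simp: M_def)
  have FM: "(\<lambda>x. M *\<^sub>R c + x) ` K \<subseteq> (\<lambda>x. M *\<^sub>R x) ` C"
  proof clarify
    fix x assume "x \<in> K"
    then obtain c' where "c' \<in> C" "x = M *\<^sub>R (c' - c)"
      using scaled_cball[OF e(2,1) M(1)] B M by metis
    then show "M *\<^sub>R c + x \<in> (\<lambda>x. M *\<^sub>R x) ` C" by (auto simp: algebra_simps)
  qed
  define G where "G = (\<lambda>p::real \<times> 'a. (fst p, fst p *\<^sub>R snd p)) ` ({0..M} \<times> C)"
  have cG: "compact G" unfolding G_def
    by (intro compact_continuous_image continuous_intros compact_Times cC compact_Icc)
  define P where "P = (\<Inter>x\<in>K. (\<lambda>p::real \<times> 'a. (fst p, snd p + x)) -` G)"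
  obtain x0 where x0: "x0 \<in> K" using K by auto
  have cP: "compact P"
  proof -
    have "closed P" unfolding P_def
      by (intro closed_INT ballI closed_vimage compact_imp_closed cG continuous_intros)
    moreover have "P \<subseteq> (\<lambda>q. (fst q, snd q - x0)) ` G"
    proof
      fix p assume "p \<in> P"
      then have "(fst p, snd p + x0) \<in> G" using x0 by (auto simp: P_def)
      then show "p \<in> (\<lambda>q. (fst q, snd q - x0)) ` G" by (intro image_eqI[of _ _ "(fst p, snd p + x0)"]) auto
    qed
    moreover have "compact ((\<lambda>q. (fst q, snd q - x0)) ` G)"
      by (intro compact_continuous_image continuous_intros cG)
    ultimately show ?thesis using closed_subset_compact by blast
  qed
  have Piff: "(l, t) \<in> P \<longleftrightarrow> 0 \<le> l \<and> l \<le> M \<and> (\<lambda>x. t + x) ` K \<subseteq> (\<lambda>x. l *\<^sub>R x) ` C" for l t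
    using x0 by (fastforce simp: P_def G_def image_iff)
  have "(M, M *\<^sub>R c) \<in> P" using FM M by (simp add: Piff)
  then obtain p where p: "p \<in> P" "\<And>q. q \<in> P \<Longrightarrow> fst p \<le> fst q"
    using continuous_attains_inf[OF cP, of fst] continuous_on_fst[OF continuous_on_id] by fast
  have 1: "?F (fst p)" using p(1) Piff by (metis prod.collapse)
  have 2: "fst p \<le> l" if l: "?F l" for l
  proof (cases "l \<le> M")
    case True
    then show ?thesis using l p(2) Piff by (metis fst_conv)
  next
    case False
    then show ?thesis using p(1) Piff by (metis order.trans linear prod.collapse)
  qed
  have eq: "circumradius K C = fst p"
    unfolding circumradius_def by (intro Least_equality) (use 1 2 in auto)
  show "?F (circumradius K C)" using 1 eq by simp
  show "circumradius K C \<le> l" if "0 \<le> l" "(\<lambda>x. t + x) ` K \<subseteq> (\<lambda>x. l *\<^sub>R x) ` C" for l t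
    using 2 that eq by auto
qed

text \<open>
  Again the admissible pairs of a ratio and a translation vector form a compact set. Two distinct
  points of the gauge bound the ratio, and then one of them bounds the translation.
\<close>

lemma inradius_greatest:
  fixes K C :: "'a::euclidean_space set"
  assumes K: "compact K" "K \<noteq> {}" and C: "C \<in> gauges"
  shows "0 \<le> inradius K C \<and> (\<exists>t. (\<lambda>x. inradius K C *\<^sub>R x) ` C \<subseteq> (\<lambda>x. t + x) ` K)"
    and "\<And>l t. 0 \<le> l \<Longrightarrow> (\<lambda>x. l *\<^sub>R x) ` C \<subseteq> (\<lambda>x. t + x) ` K \<Longrightarrow> l \<le> inradius K C"
proof -
  let ?F = "\<lambda>l. 0 \<le> l \<and> (\<exists>t. (\<lambda>x. l *\<^sub>R x) ` C \<subseteq> (\<lambda>x. t + x) ` K)"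
  obtain c e where e: "e > 0" "cball c e \<subseteq> C" using gauge_contains_ball[OF C] .
  have cinC: "c \<in> C" using e by auto
  obtain b :: 'a where b: "b \<in> Basis" using nonempty_Basis by blast
  have c'inC: "c + e *\<^sub>R b \<in> C" using e b by (auto simp: dist_norm)
  obtain B where B: "B > 0" "\<And>x. x \<in> K \<Longrightarrow> norm x \<le> B"
    using K compact_imp_bounded bounded_pos by metis
  define P where "P = ({0..} \<times> UNIV) \<inter> (\<Inter>x\<in>C. (\<lambda>p::real \<times> 'a. fst p *\<^sub>R x - snd p) -` K)"
  have Piff: "(l, t) \<in> P \<longleftrightarrow> 0 \<le> l \<and> (\<lambda>x. l *\<^sub>R x) ` C \<subseteq> (\<lambda>x. t + x) ` K" for l t
  proof -
    have "(l *\<^sub>R x - t \<in> K) = (l *\<^sub>R x \<in> (\<lambda>x. t + x) ` K)" for x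
      by (metis (no_types, lifting) add_diff_cancel_left' diff_add_cancel add.commute image_iff)
    then show ?thesis by (auto simp: P_def)
  qed
  have cP: "compact P"
  proof -
    have clK: "closed K" using K(1) by (rule compact_imp_closed)
    have "closed P" unfolding P_def
      by (intro closed_Int closed_Times closed_INT ballI closed_vimage clK closed_atLeast closed_UNIV continuous_intros)
    moreover have "P \<subseteq> {0..2*B/e} \<times> cball 0 (2*B/e * norm c + B)"
    proof (rule subrelI)
      fix l t assume "(l, t) \<in> P"
      then have l: "0 \<le> l" "l *\<^sub>R c - t \<in> K" "l *\<^sub>R (c + e *\<^sub>R b) - t \<in> K"
        using cinC c'inC by (auto simp: P_def)
      have "l * e = norm ((l *\<^sub>R (c + e *\<^sub>R b) - t) - (l *\<^sub>R c - t))"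
        using l e b by (simp add: algebra_simps)
      also have "\<dots> \<le> B + B" using B l norm_triangle_ineq4 by (meson add_mono order.trans)
      finally have lb: "l \<le> 2*B/e" using e by (simp add: field_simps)
      have "norm t = norm (l *\<^sub>R c - (l *\<^sub>R c - t))" by simp
      also have "\<dots> \<le> norm (l *\<^sub>R c) + norm (l *\<^sub>R c - t)" by (rule norm_triangle_ineq4)
      also have "\<dots> \<le> 2*B/e * norm c + B"
        using mult_right_mono[OF lb norm_ge_zero[of c]] B(2)[OF l(2)] l(1) by simp
      finally show "(l, t) \<in> {0..2*B/e} \<times> cball 0 (2*B/e * norm c + B)" using l lb by auto
    qed
    moreover have "compact ({0..2*B/e} \<times> cball (0::'a) (2*B/e * norm c + B))"
      by (intro compact_Times compact_Icc compact_cball)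
    ultimately show ?thesis using closed_subset_compact by blast
  qed
  obtain x0 where "x0 \<in> K" using K by auto
  then have "(0, - x0) \<in> P" by (auto simp: P_def)
  then obtain p where p: "p \<in> P" "\<And>q. q \<in> P \<Longrightarrow> fst q \<le> fst p"
    using continuous_attains_sup[OF cP, of fst] continuous_on_fst[OF continuous_on_id] by fast
  have 1: "?F (fst p)" using p(1) Piff by (metis prod.collapse)
  have 2: "l \<le> fst p" if l: "?F l" for l
    using l p(2) Piff by (metis fst_conv)
  have eq: "inradius K C = fst p"
    unfolding inradius_def by (intro Greatest_equality) (use 1 2 in auto)
  show "?F (inradius K C)" using 1 eq by simp
  show "l \<le> inradius K C" if "0 \<le> l" "(\<lambda>x. l *\<^sub>R x) ` C \<subseteq> (\<lambda>x. t + x) ` K" for l t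
    using 2 that eq by auto
qed

text \<open>
  The next two lemmas together say that the circumradius of a pair is the gauge norm of the
  difference \<open>x - y\<close> whose unit ball is the difference body of \<open>C\<close>.
\<close>

lemma circumradius_pair_le:
  fixes C :: "'a::euclidean_space set"
  assumes "C \<in> gauges" "0 \<le> l" "c \<in> C" "c' \<in> C" "x - y = l *\<^sub>R (c - c')"
  shows "circumradius {x, y} C \<le> l"
proof (rule circumradius_least(2))
  have "l *\<^sub>R c - x + y = l *\<^sub>R c'" using assms(5) by (simp add: algebra_simps)
  then show "(\<lambda>z. (l *\<^sub>R c - x) + z) ` {x, y} \<subseteq> (\<lambda>z. l *\<^sub>R z) ` C"
    using assms(3,4) by auto
qed (use assms in auto)

lemma circumradius_pair_attained:
  fixes C :: "'a::euclidean_space set"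
  assumes "C \<in> gauges"
  obtains c c' where "c \<in> C" "c' \<in> C" "x - y = circumradius {x, y} C *\<^sub>R (c - c')"
    "0 \<le> circumradius {x, y} C"
proof -
  let ?l = "circumradius {x, y} C"
  obtain t where l: "0 \<le> ?l" and t: "(\<lambda>z. t + z) ` {x, y} \<subseteq> (\<lambda>z. ?l *\<^sub>R z) ` C"
    using circumradius_least(1)[of "{x, y}" C] assms by auto
  then obtain c c' where "c \<in> C" "c' \<in> C" "t + x = ?l *\<^sub>R c" "t + y = ?l *\<^sub>R c'" by auto
  moreover have "x - y = (t + x) - (t + y)" by simp
  ultimately show thesis using that l by (metis scaleR_right_diff_distrib)
qed

text \<open>
  The triangle inequality for the norm of the difference body, with the norm of the perturbation
  estimated by means of a ball inside the gauge. It makes the circumradius of a pair continuous, so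
  that the diameter is attained.
\<close>

lemma circumradius_pair_lipschitz:
  fixes C :: "'a::euclidean_space set"
  assumes C: "C \<in> gauges" and e: "e > 0" "cball c e \<subseteq> C"
  shows "circumradius {x, y} C \<le> circumradius {x', y'} C + norm ((x - y) - (x' - y')) / e"
proof -
  let ?l = "circumradius {x', y'} C" and ?l' = "norm ((x - y) - (x' - y')) / e"
  have cc: "c \<in> C" using e by auto
  have cv: "convex C" using C by (auto simp: gauges_def convex_bodies_def)
  have l': "?l' \<ge> 0" using e by auto
  obtain c1 c2 where 1: "c1 \<in> C" "c2 \<in> C" "x' - y' = ?l *\<^sub>R (c1 - c2)" "?l \<ge> 0"
    using circumradius_pair_attained[OF C] .
  obtain c' where 2: "c' \<in> C" "(x - y) - (x' - y') = ?l' *\<^sub>R (c' - c)"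
    using scaled_cball[OF e(2,1) l'] e by auto
  have sum: "\<exists>s\<in>C. l *\<^sub>R a + m *\<^sub>R b = (l + m) *\<^sub>R s"
    if "a \<in> C" "b \<in> C" "0 \<le> l" "0 \<le> m" for a b and l m :: real
  proof (cases "l + m = 0")
    case True
    then have "l = 0" "m = 0" using that by auto
    then show ?thesis using that by auto
  next
    case False
    then have "(l/(l+m)) *\<^sub>R a + (m/(l+m)) *\<^sub>R b \<in> C"
      using that cv by (intro convexD) (auto simp flip: add_divide_distrib)
    then show ?thesis using False by (intro bexI[of _ "(l/(l+m)) *\<^sub>R a + (m/(l+m)) *\<^sub>R b"])
      (auto simp: scaleR_right_distrib)
  qed
  obtain s where s: "s \<in> C" "?l *\<^sub>R c1 + ?l' *\<^sub>R c' = (?l + ?l') *\<^sub>R s" using sum 1 2 l' by metis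
  obtain s' where s': "s' \<in> C" "?l *\<^sub>R c2 + ?l' *\<^sub>R c = (?l + ?l') *\<^sub>R s'" using sum 1 cc l' by metis
  have split: "a + b = (l *\<^sub>R p + m *\<^sub>R r) - (l *\<^sub>R q + m *\<^sub>R s)"
    if "a = l *\<^sub>R (p - q)" "b = m *\<^sub>R (r - s)" for a b p q r s :: 'a and l m
    unfolding that by (simp add: algebra_simps)
  have "x - y = (x' - y') + ((x - y) - (x' - y'))" by simp
  also have "\<dots> = (?l *\<^sub>R c1 + ?l' *\<^sub>R c') - (?l *\<^sub>R c2 + ?l' *\<^sub>R c)"
    using split[OF 1(3) 2(2)] .
  finally have "x - y = (?l + ?l') *\<^sub>R (s - s')" using s s' by (simp add: scaleR_right_diff_distrib)
  then show ?thesis using circumradius_pair_le[OF C] s s' 1(4) l' by (meson add_nonneg_nonneg)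
qed

lemma gauge_diameter_attained:
  fixes K C :: "'a::euclidean_space set"
  assumes K: "compact K" "K \<noteq> {}" and C: "C \<in> gauges"
  shows "\<And>x y. x \<in> K \<Longrightarrow> y \<in> K \<Longrightarrow> circumradius {x, y} C \<le> gauge_diameter K C / 2"
    and "\<exists>x\<in>K. \<exists>y\<in>K. gauge_diameter K C / 2 = circumradius {x, y} C"
proof -
  obtain c e where e: "e > 0" "cball c e \<subseteq> C" using gauge_contains_ball[OF C] .
  let ?g = "\<lambda>p. circumradius {fst p, snd p} C"
  have "continuous_on (K \<times> K) ?g"
  proof (rule continuous_onI)
    fix p :: "'a \<times> 'a" and d :: real assume d: "d > 0"
    have "dist (?g q) (?g p) \<le> d" if "dist q p < d * e / 2" for q
    proof -
      have "norm ((fst q - snd q) - (fst p - snd p)) \<le> dist (fst q) (fst p) + dist (snd q) (snd p)"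
        unfolding dist_norm by (rule order.trans[OF _ norm_triangle_ineq4]) (simp add: algebra_simps)
      also have "\<dots> \<le> 2 * dist q p" using dist_fst_le[of q p] dist_snd_le[of q p] by linarith
      also have "\<dots> \<le> d * e" using that by simp
      finally have n: "norm ((fst q - snd q) - (fst p - snd p)) / e \<le> d" using e by (simp add: field_simps)
      then have n': "norm ((fst p - snd p) - (fst q - snd q)) / e \<le> d" by (simp add: norm_minus_commute)
      show ?thesis using circumradius_pair_lipschitz[OF C e, of "fst p" "snd p" "fst q" "snd q"] n n'
          circumradius_pair_lipschitz[OF C e, of "fst q" "snd q" "fst p" "snd p"]
        by (simp add: dist_real_def)
    qed
    then show "\<exists>d'>0. \<forall>q\<in>K \<times> K. dist q p < d' \<longrightarrow> dist (?g q) (?g p) \<le> d"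
      using d e by (intro exI[of _ "d * e / 2"]) auto
  qed
  moreover have "compact (K \<times> K)" "K \<times> K \<noteq> {}" using K by (auto simp: compact_Times)
  ultimately obtain p where p: "p \<in> K \<times> K" "\<And>q. q \<in> K \<times> K \<Longrightarrow> ?g q \<le> ?g p"
    using continuous_attains_sup[of "K \<times> K" ?g] by blast
  have "(GREATEST d::real. \<exists>x\<in>K. \<exists>y\<in>K. d = circumradius {x, y} C) = ?g p"
  proof (rule Greatest_equality)
    show "\<exists>x\<in>K. \<exists>y\<in>K. ?g p = circumradius {x, y} C"
      by (rule bexI[of _ "fst p"], rule bexI[of _ "snd p"]) (use p(1) in auto)
  qed (use p(2) in auto)
  then have eq: "gauge_diameter K C / 2 = ?g p" by (simp add: gauge_diameter_def)
  show "circumradius {x, y} C \<le> gauge_diameter K C / 2" if "x \<in> K" "y \<in> K" for x y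
    using p(2)[of "(x, y)"] that eq by simp
  show "\<exists>x\<in>K. \<exists>y\<in>K. gauge_diameter K C / 2 = circumradius {x, y} C"
    by (rule bexI[of _ "fst p"], rule bexI[of _ "snd p"]) (use eq p(1) in auto)
qed

section \<open>The region of admissible ratios\<close>

definition radii_region :: "(real \<times> real) set" where
  "radii_region = {(r, d). 1 / 2 \<le> d \<and> d \<le> 1 \<and> d * (1 - d) \<le> r \<and> 2 * r \<le> 3 * d - 1}"

section \<open>Barycentric coordinates and radii with respect to a triangle\<close>

lemma cross_noncollinear:
  fixes x y :: "real^2"
  assumes "\<not> collinear {0, x, y}"
  shows "x$1 * y$2 - x$2 * y$1 \<noteq> 0"
proof
  assume D: "x$1 * y$2 - x$2 * y$1 = 0"
  have x: "x \<noteq> 0" using assms by (auto simp: collinear_lemma)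
  have "\<exists>k. y = k *\<^sub>R x"
  proof (cases "x$1 = 0")
    case True
    then have x2: "x$2 \<noteq> 0" using x by (simp add: vec_eq_iff forall_2)
    then have "y$1 = 0" using D True by simp
    then show ?thesis using x2 True by (intro exI[of _ "y$2 / x$2"]) (simp add: vec_eq_iff forall_2)
  next
    case False
    then show ?thesis using D by (intro exI[of _ "y$1 / x$1"]) (simp add: vec_eq_iff forall_2 field_simps)
  qed
  then show False using assms by (simp add: collinear_lemma)
qed

text \<open>
  The barycentric coordinates of the triangle \<open>a b c\<close> as affine functions \<open>x \<mapsto> n\<^sub>i \<bullet> x + k\<^sub>i\<close>. The linear
  parts are kept separate because translation vectors enter only through them.
\<close>

locale barycentric =
  fixes a b c n1 n2 n3 :: "real^2" and k1 k2 k3 :: real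
  assumes nsum: "n1 + n2 + n3 = 0" and ksum: "k1 + k2 + k3 = 1"
    and repr: "x = (n1 \<bullet> x + k1) *\<^sub>R a + (n2 \<bullet> x + k2) *\<^sub>R b + (n3 \<bullet> x + k3) *\<^sub>R c"
    and vertices: "n1 \<bullet> a = 1 - k1" "n1 \<bullet> b = - k1" "n1 \<bullet> c = - k1"
      "n2 \<bullet> a = - k2" "n2 \<bullet> b = 1 - k2" "n2 \<bullet> c = - k2"
      "n3 \<bullet> a = - k3" "n3 \<bullet> b = - k3" "n3 \<bullet> c = 1 - k3"
begin

definition "L1 x = n1 \<bullet> x + k1"
definition "L2 x = n2 \<bullet> x + k2"
definition "L3 x = n3 \<bullet> x + k3"

lemmas L_defs = L1_def L2_def L3_def

abbreviation "S \<equiv> convex hull {a, b, c}"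

lemma nsum_inner: "n1 \<bullet> x + n2 \<bullet> x + n3 \<bullet> x = 0"
  using nsum by (metis inner_add_left inner_zero_left)

lemma Lsum: "L1 x + L2 x + L3 x = 1"
  using nsum_inner[of x] ksum by (simp add: L_defs)

lemma inner_comb:
  "n1 \<bullet> (u *\<^sub>R a + v *\<^sub>R b + w *\<^sub>R c) = u - (u + v + w) * k1"
  "n2 \<bullet> (u *\<^sub>R a + v *\<^sub>R b + w *\<^sub>R c) = v - (u + v + w) * k2"
  "n3 \<bullet> (u *\<^sub>R a + v *\<^sub>R b + w *\<^sub>R c) = w - (u + v + w) * k3"
  by (simp_all add: inner_add_right vertices algebra_simps)

lemma coords:
  assumes "u + v + w = 1"
  shows "L1 (u *\<^sub>R a + v *\<^sub>R b + w *\<^sub>R c) = u" "L2 (u *\<^sub>R a + v *\<^sub>R b + w *\<^sub>R c) = v"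
    "L3 (u *\<^sub>R a + v *\<^sub>R b + w *\<^sub>R c) = w"
  unfolding L_defs inner_comb assms by simp_all

lemma mem_S: "x \<in> S \<longleftrightarrow> 0 \<le> L1 x \<and> 0 \<le> L2 x \<and> 0 \<le> L3 x"
proof
  assume "x \<in> S"
  then obtain u v w where "x = u *\<^sub>R a + v *\<^sub>R b + w *\<^sub>R c" "0 \<le> u" "0 \<le> v" "0 \<le> w" "u + v + w = 1"
    unfolding convex_hull_3 by blast
  then show "0 \<le> L1 x \<and> 0 \<le> L2 x \<and> 0 \<le> L3 x" using coords by simp
next
  assume "0 \<le> L1 x \<and> 0 \<le> L2 x \<and> 0 \<le> L3 x"
  moreover have "x = L1 x *\<^sub>R a + L2 x *\<^sub>R b + L3 x *\<^sub>R c" using repr[of x] by (simp add: L_defs)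
  ultimately show "x \<in> S" unfolding convex_hull_3 using Lsum[of x] by blast
qed

lemma mem_S_comb:
  assumes "0 \<le> u" "0 \<le> v" "0 \<le> w" "u + v + w = 1"
  shows "u *\<^sub>R a + v *\<^sub>R b + w *\<^sub>R c \<in> S"
  using assms unfolding convex_hull_3 by blast

text \<open>
  In a copy of the triangle with ratio \<open>l\<close>, each of the three touching points gives a lower bound for
  the value of one linear part \<open>n\<^sub>i\<close> at the translation vector. The linear parts add up to zero, so adding the three
  bounds eliminates the translation vector and leaves \<open>1 \<le> l\<close>.
\<close>

lemma circumradius_touching_all_edges:
  assumes "K \<subseteq> S" and p: "p1 \<in> K" "L1 p1 = 0" "p2 \<in> K" "L2 p2 = 0" "p3 \<in> K" "L3 p3 = 0"
  shows "circumradius K S = 1"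
  unfolding circumradius_def
proof (rule Least_equality)
  show "0 \<le> (1::real) \<and> (\<exists>t. (\<lambda>x. t + x) ` K \<subseteq> (\<lambda>x. 1 *\<^sub>R x) ` S)"
    using assms(1) by (intro conjI exI[of _ 0]) auto
  fix l :: real assume "0 \<le> l \<and> (\<exists>t. (\<lambda>x. t + x) ` K \<subseteq> (\<lambda>x. l *\<^sub>R x) ` S)"
  then obtain t where l: "0 \<le> l" and t: "(\<lambda>x. t + x) ` K \<subseteq> (\<lambda>x. l *\<^sub>R x) ` S" by blast
  obtain s1 where s1: "s1 \<in> S" "t + p1 = l *\<^sub>R s1" using t p(1) by blast
  obtain s2 where s2: "s2 \<in> S" "t + p2 = l *\<^sub>R s2" using t p(3) by blast
  obtain s3 where s3: "s3 \<in> S" "t + p3 = l *\<^sub>R s3" using t p(5) by blast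
  have edge: "(1 - l) * k \<le> n \<bullet> t" if "t + q = l *\<^sub>R s" "n \<bullet> q + k = 0" "0 \<le> n \<bullet> s + k" for n q s k
  proof -
    have "n \<bullet> t + n \<bullet> q = l * (n \<bullet> s)" using that(1) by (metis inner_add_right inner_scaleR_right)
    moreover have "0 \<le> l * (n \<bullet> s + k)" using l that(3) by simp
    ultimately show ?thesis using that(2) by (simp add: algebra_simps)
  qed
  have "(1 - l) * k1 \<le> n1 \<bullet> t" using edge[OF s1(2)] s1(1) p(2) by (simp add: mem_S L_defs)
  moreover have "(1 - l) * k2 \<le> n2 \<bullet> t" using edge[OF s2(2)] s2(1) p(4) by (simp add: mem_S L_defs)
  moreover have "(1 - l) * k3 \<le> n3 \<bullet> t" using edge[OF s3(2)] s3(1) p(6) by (simp add: mem_S L_defs)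
  ultimately have "(1 - l) * (k1 + k2 + k3) \<le> 0" using nsum_inner[of t] by (simp add: algebra_simps)
  then show "1 \<le> l" using ksum by simp
qed

text \<open>
  The coordinate differences add up to zero, so their positive parts and their negative parts have
  the same sum, and this sum is at most \<open>d\<close> because at least two of the three differences agree in
  sign, which makes it the absolute value of one difference. The positive parts give the point \<open>s\<close> and
  the negative parts the point \<open>s'\<close>; the remainder \<open>f\<close> up to \<open>d\<close> is added to the same coordinate in both.
\<close>

lemma difference_in_scaled_triangle:
  assumes "0 < d" and diff: "\<bar>L1 x - L1 y\<bar> \<le> d" "\<bar>L2 x - L2 y\<bar> \<le> d" "\<bar>L3 x - L3 y\<bar> \<le> d"
  shows "\<exists>s\<in>S. \<exists>s'\<in>S. x - y = d *\<^sub>R (s - s')"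
proof -
  define e1 e2 e3 where "e1 = L1 x - L1 y" "e2 = L2 x - L2 y" "e3 = L3 x - L3 y"
  note e_defs = e1_e2_e3_def
  have esum: "e1 + e2 + e3 = 0" using Lsum[of x] Lsum[of y] by (simp add: e_defs)
  define f where "f = d - (max e1 0 + max e2 0 + max e3 0)"
  have parts: "max e 0 - max (- e) 0 = e" for e :: real by (simp add: max_def)
  have f: "0 \<le> f" using diff esum unfolding f_def e_defs[symmetric] by linarith
  have f': "f = d - (max (- e1) 0 + max (- e2) 0 + max (- e3) 0)"
    using esum parts[of e1] parts[of e2] parts[of e3] unfolding f_def by linarith
  define s s' where "s = ((max e1 0 + f) / d) *\<^sub>R a + (max e2 0 / d) *\<^sub>R b + (max e3 0 / d) *\<^sub>R c"
    "s' = ((max (- e1) 0 + f) / d) *\<^sub>R a + (max (- e2) 0 / d) *\<^sub>R b + (max (- e3) 0 / d) *\<^sub>R c"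
  note s_defs = s_s'_def
  have "s \<in> S" unfolding s_defs
  proof (rule mem_S_comb)
    have "(max e1 0 + f) + max e2 0 + max e3 0 = d" by (simp add: f_def)
    then show "(max e1 0 + f) / d + max e2 0 / d + max e3 0 / d = 1"
      using \<open>0 < d\<close> by (simp only: add_divide_distrib[symmetric]) simp
  qed (use f \<open>0 < d\<close> in simp_all)
  moreover have "s' \<in> S" unfolding s_defs
  proof (rule mem_S_comb)
    have "(max (- e1) 0 + f) + max (- e2) 0 + max (- e3) 0 = d" by (simp add: f')
    then show "(max (- e1) 0 + f) / d + max (- e2) 0 / d + max (- e3) 0 / d = 1"
      using \<open>0 < d\<close> by (simp only: add_divide_distrib[symmetric]) simp
  qed (use f \<open>0 < d\<close> in simp_all)
  moreover have "x - y = d *\<^sub>R (s - s')"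
  proof -
    have "d *\<^sub>R s = (max e1 0 + f) *\<^sub>R a + max e2 0 *\<^sub>R b + max e3 0 *\<^sub>R c"
      "d *\<^sub>R s' = (max (- e1) 0 + f) *\<^sub>R a + max (- e2) 0 *\<^sub>R b + max (- e3) 0 *\<^sub>R c"
      using \<open>0 < d\<close> unfolding s_defs by (simp_all add: scaleR_right_distrib)
    then have "d *\<^sub>R (s - s') = (max e1 0 - max (- e1) 0) *\<^sub>R a + (max e2 0 - max (- e2) 0) *\<^sub>R b
        + (max e3 0 - max (- e3) 0) *\<^sub>R c"
      unfolding scaleR_right_diff_distrib by (simp add: scaleR_left_distrib scaleR_left_diff_distrib)
    also have "\<dots> = e1 *\<^sub>R a + e2 *\<^sub>R b + e3 *\<^sub>R c" unfolding parts ..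
    also have "\<dots> = (L1 x *\<^sub>R a + L2 x *\<^sub>R b + L3 x *\<^sub>R c) - (L1 y *\<^sub>R a + L2 y *\<^sub>R b + L3 y *\<^sub>R c)"
      unfolding e_defs by (simp add: scaleR_left_diff_distrib)
    also have "\<dots> = x - y" using repr[of x] repr[of y] by (simp add: L_defs)
    finally show ?thesis by simp
  qed
  ultimately show ?thesis by blast
qed

lemma gauge_diameter_coordinate_width:
  assumes S: "S \<in> gauges" and K: "K \<subseteq> S" and "0 < d"
    and le: "\<And>x. x \<in> K \<Longrightarrow> L1 x \<le> d \<and> L2 x \<le> d \<and> L3 x \<le> d"
    and top: "p \<in> K" "L3 p = d" and bot: "q \<in> K" "L3 q = 0"
  shows "gauge_diameter K S = 2 * d"
proof -
  have up: "circumradius {x, y} S \<le> d" if "x \<in> K" "y \<in> K" for x y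
  proof -
    have "0 \<le> L1 x" "0 \<le> L2 x" "0 \<le> L3 x" "0 \<le> L1 y" "0 \<le> L2 y" "0 \<le> L3 y"
      using K that by (auto simp: mem_S)
    then have "\<exists>s\<in>S. \<exists>s'\<in>S. x - y = d *\<^sub>R (s - s')"
      using le[OF that(1)] le[OF that(2)] \<open>0 < d\<close> by (intro difference_in_scaled_triangle) auto
    then show ?thesis using circumradius_pair_le[OF S] \<open>0 < d\<close> by fastforce
  qed
  have "d \<le> circumradius {p, q} S"
  proof -
    let ?l = "circumradius {p, q} S"
    obtain s s' where s: "s \<in> S" "s' \<in> S" "p - q = ?l *\<^sub>R (s - s')" "0 \<le> ?l"
      using circumradius_pair_attained[OF S] .
    have "d = n3 \<bullet> (p - q)" using top bot by (simp add: L_defs inner_diff_right)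
    also have "\<dots> = ?l * (L3 s - L3 s')" unfolding s(3) by (simp add: L_defs inner_diff_right)
    also have "\<dots> \<le> ?l * 1"
      using s Lsum[of s] by (intro mult_left_mono) (auto simp: mem_S)
    finally show ?thesis by simp
  qed
  then have "circumradius {p, q} S = d" using up[OF top(1) bot(1)] by simp
  then have "(GREATEST d. \<exists>x\<in>K. \<exists>y\<in>K. d = circumradius {x, y} S) = d"
    using up top bot by (intro Greatest_equality) auto
  then show ?thesis by (simp add: gauge_diameter_def)
qed

text \<open>
  The truncation at \<open>L3 = d\<close> fixes the diameter. The other two lines are mirror images of each other and
  control the inradius: \<open>\<alpha>\<close> determines how much of the edge \<open>a b\<close> remains, and \<open>\<kappa>\<close> determines their slope,
  from parallel to the sides \<open>b c\<close> and \<open>a c\<close>, respectively, at \<open>\<kappa> = 0\<close> to parallel to the sides \<open>a c\<close>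
  and \<open>b c\<close> at \<open>\<kappa> = 1\<close>.
\<close>
definition truncated_triangle :: "real \<Rightarrow> real \<Rightarrow> real \<Rightarrow> (real^2) set" where
  "truncated_triangle d \<alpha> \<kappa> = {x \<in> S. L3 x \<le> d \<and> L1 x + \<kappa> * L3 x \<le> \<alpha> \<and> L2 x + \<kappa> * L3 x \<le> \<alpha>}"

lemma truncated_triangle_convex_compact: "convex (truncated_triangle d \<alpha> \<kappa>)" "compact (truncated_triangle d \<alpha> \<kappa>)"
proof -
  have eq: "truncated_triangle d \<alpha> \<kappa> = S \<inter> ({x. n3 \<bullet> x \<le> d - k3} \<inter> ({x. (n1 + \<kappa> *\<^sub>R n3) \<bullet> x \<le> \<alpha> - k1 - \<kappa> * k3}
    \<inter> {x. (n2 + \<kappa> *\<^sub>R n3) \<bullet> x \<le> \<alpha> - k2 - \<kappa> * k3}))"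
    unfolding truncated_triangle_def L_defs by (auto simp: inner_add_left algebra_simps)
  show "convex (truncated_triangle d \<alpha> \<kappa>)" unfolding eq
    by (intro convex_Int convex_halfspace_le convex_convex_hull)
  show "compact (truncated_triangle d \<alpha> \<kappa>)" unfolding eq
    by (intro compact_Int_closed closed_Int closed_halfspace_le compact_convex_hull finite_imp_compact) auto
qed

text \<open>
  A homothetic copy of ratio \<open>l\<close> consists of the points whose coordinates are at least \<open>m1, m2, m3\<close>,
  where \<open>m1 + m2 + m3 = 1 - l\<close>. The two slanted lines give \<open>l \<le> 2 \<alpha> - 1 + (1 - 2 \<kappa>) m3\<close>. For
  \<open>\<kappa> \<le> 1/2\<close> the bound is best when the copy is pushed against the line \<open>L3 = d\<close>, for \<open>\<kappa> \<ge> 1/2\<close> when it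
  rests on the edge \<open>L3 = 0\<close>. The hypothesis on \<open>m\<close> lists these two optimal positions, and by symmetry
  an optimal copy can be placed with \<open>m1 = m2\<close>.
\<close>

lemma inradius_truncated_triangle:
  assumes "0 \<le> \<kappa>" "\<kappa> \<le> 1" "d \<le> 1" "0 \<le> r" "0 \<le> m" "m + r \<le> d"
    and r: "r = 2 * \<alpha> - 1 + (1 - 2 * \<kappa>) * m"
    and ex: "\<kappa> \<le> 1 / 2 \<and> m = d - r \<or> 1 / 2 \<le> \<kappa> \<and> m = 0"
  shows "inradius (truncated_triangle d \<alpha> \<kappa>) S = r"
  unfolding inradius_def
proof (rule Greatest_equality)
  let ?K = "truncated_triangle d \<alpha> \<kappa>"
  define m' where "m' = (1 - r - m) / 2"
  define w where "w = m' *\<^sub>R a + m' *\<^sub>R b + m *\<^sub>R c"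
  have m': "0 \<le> m'" "m' + m' + m = 1 - r" using assms by (auto simp: m'_def)
  have "(\<lambda>x. r *\<^sub>R x) ` S \<subseteq> (\<lambda>x. - w + x) ` ?K"
  proof clarify
    fix s assume "s \<in> S"
    then have s: "0 \<le> L1 s" "0 \<le> L2 s" "0 \<le> L3 s" by (auto simp: mem_S)
    have L: "L1 (r *\<^sub>R s + w) = r * L1 s + m'" "L2 (r *\<^sub>R s + w) = r * L2 s + m'" "L3 (r *\<^sub>R s + w) = r * L3 s + m"
      unfolding L_defs w_def inner_add_right[of _ "r *\<^sub>R s"] inner_comb m'(2) by (simp_all add: algebra_simps)
    have one: "r * x \<le> r" if "x \<le> 1" for x using that \<open>0 \<le> r\<close> by (simp add: mult_left_le)
    have k: "\<kappa> * L3 s \<le> L3 s" using assms s by (simp add: mult_left_le_one_le)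
    have a: "r + m' + \<kappa> * m = \<alpha>" unfolding r m'_def by (simp add: field_simps)
    have "r * L3 s \<le> r" by (rule one) (use s Lsum[of s] in linarith)
    moreover have "r * (L1 s + \<kappa> * L3 s) \<le> r" by (rule one) (use s k Lsum[of s] in linarith)
    moreover have "r * (L2 s + \<kappa> * L3 s) \<le> r" by (rule one) (use s k Lsum[of s] in linarith)
    ultimately have "r *\<^sub>R s + w \<in> ?K"
      unfolding truncated_triangle_def mem_S mem_Collect_eq L using a m'(1) assms(4-6) s by (auto simp: algebra_simps)
    then show "r *\<^sub>R s \<in> (\<lambda>x. - w + x) ` ?K" by (intro image_eqI[of _ _ "r *\<^sub>R s + w"]) auto
  qed
  then show "0 \<le> r \<and> (\<exists>t. (\<lambda>x. r *\<^sub>R x) ` S \<subseteq> (\<lambda>x. t + x) ` ?K)" using \<open>0 \<le> r\<close> by blast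
next
  let ?K = "truncated_triangle d \<alpha> \<kappa>"
  fix l :: real assume "0 \<le> l \<and> (\<exists>t. (\<lambda>x. l *\<^sub>R x) ` S \<subseteq> (\<lambda>x. t + x) ` ?K)"
  then obtain t where l: "0 \<le> l" and t: "(\<lambda>x. l *\<^sub>R x) ` S \<subseteq> (\<lambda>x. t + x) ` ?K" by blast
  have vS: "a \<in> S" "b \<in> S" "c \<in> S" by (auto intro: hull_inc)
  have inK: "l *\<^sub>R s - t \<in> ?K" if "s \<in> S" for s
  proof -
    obtain q where "q \<in> ?K" "l *\<^sub>R s = t + q" using t \<open>s \<in> S\<close> by blast
    then show ?thesis by simp
  qed
  define m1 m2 m3 where "m1 = (1 - l) * k1 - n1 \<bullet> t" "m2 = (1 - l) * k2 - n2 \<bullet> t" "m3 = (1 - l) * k3 - n3 \<bullet> t"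
  note m_defs = m1_m2_m3_def
  have "m1 + m2 + m3 = (1 - l) * (k1 + k2 + k3) - (n1 \<bullet> t + n2 \<bullet> t + n3 \<bullet> t)"
    unfolding m_defs by (simp add: algebra_simps)
  then have msum: "m1 + m2 + m3 = 1 - l" using ksum nsum_inner[of t] by simp
  have A: "L1 (l *\<^sub>R a - t) = l + m1" "L3 (l *\<^sub>R a - t) = m3"
    and B: "L2 (l *\<^sub>R b - t) = l + m2" "L3 (l *\<^sub>R b - t) = m3"
    and C: "L3 (l *\<^sub>R c - t) = l + m3"
    unfolding L_defs m_defs by (simp_all add: inner_diff_right vertices algebra_simps)
  have "l + m1 + \<kappa> * m3 \<le> \<alpha>" "0 \<le> m3" using inK[OF vS(1)] A by (auto simp: truncated_triangle_def mem_S)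
  moreover have "l + m2 + \<kappa> * m3 \<le> \<alpha>" using inK[OF vS(2)] B by (auto simp: truncated_triangle_def)
  ultimately have "l \<le> 2 * \<alpha> - 1 + (1 - 2 * \<kappa>) * m3" using msum by (simp add: algebra_simps)
  then have lr: "l - r \<le> (1 - 2 * \<kappa>) * (m3 - m)" using r by (simp add: algebra_simps)
  have md: "l + m3 \<le> d" using inK[OF vS(3)] C by (auto simp: truncated_triangle_def)
  from ex show "l \<le> r"
  proof
    assume k: "\<kappa> \<le> 1 / 2 \<and> m = d - r"
    then have "(1 - 2 * \<kappa>) * (m3 - m) \<le> (1 - 2 * \<kappa>) * (r - l)" using md by (intro mult_left_mono) auto
    then have "(2 - 2 * \<kappa>) * (l - r) \<le> 0" using lr by (simp add: algebra_simps)
    then show ?thesis using k by (simp add: mult_le_0_iff)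
  next
    assume k: "1 / 2 \<le> \<kappa> \<and> m = 0"
    then have "(1 - 2 * \<kappa>) * (m3 - m) \<le> 0" using \<open>0 \<le> m3\<close> by (intro mult_nonpos_nonneg) auto
    then show ?thesis using lr by simp
  qed
qed

section \<open>Realisation of the region\<close>

text \<open>
  The bounds on \<open>\<alpha>\<close> say that the truncation keeps the midpoint of the edge \<open>L3 = 0\<close> and the
  two endpoints of the segment \<open>L3 = d\<close>, which touch the three edges of the triangle, while it
  keeps \<open>L1\<close> and \<open>L2\<close> below \<open>d\<close>.
\<close>

lemma truncated_triangle_realises:
  assumes S: "S \<in> gauges" and d: "1 / 2 \<le> d" "d \<le> 1"
    and \<kappa>: "0 \<le> \<kappa>" "\<kappa> \<le> 1" and \<alpha>: "1 / 2 \<le> \<alpha>" "\<alpha> \<le> d" "1 - d + \<kappa> * d \<le> \<alpha>"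
    and r: "0 \<le> r" "0 \<le> m" "m + r \<le> d" "r = 2 * \<alpha> - 1 + (1 - 2 * \<kappa>) * m"
      "\<kappa> \<le> 1 / 2 \<and> m = d - r \<or> 1 / 2 \<le> \<kappa> \<and> m = 0"
  shows "(r, d) \<in> diagram S"
proof -
  let ?K = "truncated_triangle d \<alpha> \<kappa>"
  have KS: "?K \<subseteq> S" by (auto simp: truncated_triangle_def)
  define p1 p2 p3 where "p1 = 0 *\<^sub>R a + (1 - d) *\<^sub>R b + d *\<^sub>R c" "p2 = (1 - d) *\<^sub>R a + 0 *\<^sub>R b + d *\<^sub>R c"
    "p3 = (1 / 2) *\<^sub>R a + (1 / 2) *\<^sub>R b + 0 *\<^sub>R c"
  note p_defs = p1_p2_p3_def
  have Lp: "L1 p1 = 0" "L2 p1 = 1 - d" "L3 p1 = d" "L1 p2 = 1 - d" "L2 p2 = 0" "L3 p2 = d"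
    "L1 p3 = 1 / 2" "L2 p3 = 1 / 2" "L3 p3 = 0"
    unfolding p_defs by (simp_all only: coords)
  have p: "p1 \<in> ?K" "p2 \<in> ?K" "p3 \<in> ?K"
    using d \<kappa> \<alpha> by (auto simp: truncated_triangle_def mem_S Lp)
  have R: "circumradius ?K S = 1"
    by (rule circumradius_touching_all_edges[OF KS p(1) Lp(1) p(2) Lp(5) p(3) Lp(9)])
  have D: "gauge_diameter ?K S = 2 * d"
  proof (rule gauge_diameter_coordinate_width[OF S KS _ _ p(1) Lp(3) p(3) Lp(9)])
    fix x assume x: "x \<in> ?K"
    then have "0 \<le> \<kappa> * L3 x" using \<kappa> by (simp add: truncated_triangle_def mem_S)
    then show "L1 x \<le> d \<and> L2 x \<le> d \<and> L3 x \<le> d" using x \<alpha> by (auto simp: truncated_triangle_def)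
  qed (use d in auto)
  have I: "inradius ?K S = r"
    by (rule inradius_truncated_triangle[OF \<kappa> d(2) r])
  have "?K \<in> convex_bodies" using truncated_triangle_convex_compact p by (auto simp: convex_bodies_def)
  moreover have "\<not> is_singleton ?K"
  proof
    assume "is_singleton ?K"
    then have "p1 = p3" using p by (auto simp: is_singleton_def)
    then show False using Lp d by auto
  qed
  moreover have "radii_ratios ?K S = (r, d)" by (simp add: radii_ratios_def R D I)
  ultimately show ?thesis unfolding diagram_def by (metis (mono_tags, lifting) mem_Collect_eq)
qed

text \<open>
  In the first two cases the body is the trapezoid between \<open>L3 = 0\<close> and \<open>L3 = d\<close> whose slanted sides
  pass through the endpoints of the segment \<open>L3 = d\<close>; here \<open>2 \<alpha> - 1\<close> is the length of the lower
  side and \<open>1 - d\<close> that of the upper one, as fractions of the edge \<open>a b\<close>. If the lower side is the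
  longer one, its length is the inradius; if not, its length \<open>w\<close> has to satisfy
  \<open>(1 - w) r = d (1 - d)\<close>, and \<open>w = 0\<close> is the triangle with the smallest possible inradius. The lower side cannot be longer than \<open>2 d - 1\<close>. In the last case it has
  this length, and the slanted lines are turned outwards until, at \<open>\<kappa> = 0\<close>, the inradius is
  \<open>(3 d - 1) / 2\<close>.
\<close>

lemma region_subset_diagram:
  assumes S: "S \<in> gauges"
  shows "radii_region \<subseteq> diagram S"
proof clarify
  fix r d assume "(r, d) \<in> radii_region"
  then have d: "1 / 2 \<le> d" "d \<le> 1" and rd: "d * (1 - d) \<le> r" "2 * r \<le> 3 * d - 1"
    by (auto simp: radii_region_def)
  have r0: "0 \<le> r" using rd(1) d mult_nonneg_nonneg[of d "1 - d"] by linarith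
  consider (low) "1 - d \<le> r" "r \<le> 2 * d - 1" | (steep) "r < 1 - d" "2 * r \<le> d"
    | (cut) "d < 1" "d \<le> 2 * r" "2 * d - 1 \<le> r"
    using d rd by linarith
  then show "(r, d) \<in> diagram S"
  proof cases
    case low
    define \<alpha> where "\<alpha> = (1 + r) / 2"
    define \<kappa> where "\<kappa> = (\<alpha> - 1 + d) / d"
    show ?thesis
    proof (rule truncated_triangle_realises[OF S d])
      show "0 \<le> \<kappa>" "\<kappa> \<le> 1" "1 - d + \<kappa> * d \<le> \<alpha>" "\<kappa> \<le> 1 / 2 \<and> 0 = d - r \<or> 1 / 2 \<le> \<kappa> \<and> (0::real) = 0"
        using d low r0 by (auto simp: \<kappa>_def \<alpha>_def field_simps)
    qed (use d low r0 in \<open>auto simp: \<alpha>_def field_simps\<close>)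
  next
    case steep
    have d1: "d < 1" using steep r0 by linarith
    then have "0 < d * (1 - d)" using d by simp
    then have rp: "0 < r" using rd(1) by linarith
    define w where "w = 1 - d * (1 - d) / r"
    define \<alpha> where "\<alpha> = (1 + w) / 2"
    define \<kappa> where "\<kappa> = (\<alpha> - 1 + d) / d"
    have wr: "(1 - w) * r = d * (1 - d)" using rp by (simp add: w_def)
    have w0: "0 \<le> w" using rp rd(1) by (simp add: w_def)
    have w1: "w \<le> 2 * d - 1"
    proof -
      have "(2 * r) * (1 - d) \<le> d * (1 - d)" using steep d by (intro mult_right_mono) auto
      then show ?thesis using rp by (simp add: w_def field_simps)
    qed
    have w2: "w \<le> 1 - d"
    proof -
      have "d * r \<le> d * (1 - d)" using steep d by (intro mult_left_mono) auto
      then show ?thesis using rp by (simp add: w_def field_simps)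
    qed
    have \<kappa>d: "\<kappa> * d = \<alpha> - 1 + d" using d by (simp add: \<kappa>_def)
    have "d * (2 * \<alpha> - 1 + (1 - 2 * \<kappa>) * (d - r)) = d * (2 * \<alpha> - 1) + (d - 2 * (\<kappa> * d)) * (d - r)"
      by (simp add: algebra_simps)
    also have "\<dots> = d * r + (d * (1 - d) - (1 - w) * r)"
      unfolding \<kappa>d by (simp add: \<alpha>_def field_simps)
    finally have eq: "r = 2 * \<alpha> - 1 + (1 - 2 * \<kappa>) * (d - r)" using wr d by simp
    show ?thesis
    proof (rule truncated_triangle_realises[OF S d])
      show "0 \<le> \<kappa>" "\<kappa> \<le> 1" "1 - d + \<kappa> * d \<le> \<alpha>" "\<kappa> \<le> 1 / 2 \<and> d - r = d - r \<or> 1 / 2 \<le> \<kappa> \<and> d - r = 0"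
        using d w0 w1 w2 by (auto simp: \<kappa>_def \<alpha>_def field_simps)
      show "r = 2 * \<alpha> - 1 + (1 - 2 * \<kappa>) * (d - r)" by (rule eq)
    qed (use d w0 w1 r0 steep in \<open>simp_all add: \<alpha>_def\<close>)
  next
    case cut
    have dr: "0 < d - r" using cut(1) rd(2) by linarith
    define \<kappa> where "\<kappa> = (3 * d - 1 - 2 * r) / (2 * (d - r))"
    have "2 * (d - r) \<noteq> 0" using dr by simp
    then have "\<kappa> * (2 * (d - r)) = 3 * d - 1 - 2 * r"
      unfolding \<kappa>_def by (simp only: times_divide_eq_left nonzero_mult_div_cancel_right not_False_eq_True)
    then have \<kappa>r: "2 * \<kappa> * (d - r) = 3 * d - 1 - 2 * r" by (simp add: algebra_simps)
    have k0: "0 \<le> \<kappa>" using dr rd(2) by (simp add: \<kappa>_def)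
    have k1: "\<kappa> \<le> 1 / 2" using dr cut by (simp add: \<kappa>_def field_simps)
    have kd: "1 - d + \<kappa> * d \<le> d"
    proof -
      have "0 \<le> (2 * r - d) * (1 - d)" using cut by simp
      then have "(3 * d - 1 - 2 * r) * d \<le> (2 * d - 1) * (2 * (d - r))" by (simp add: algebra_simps)
      then have "\<kappa> * d \<le> 2 * d - 1" using dr unfolding \<kappa>_def by (simp add: pos_divide_le_eq)
      then show ?thesis by simp
    qed
    have eq: "r = 2 * d - 1 + (1 - 2 * \<kappa>) * (d - r)" using \<kappa>r by (simp add: algebra_simps)
    show ?thesis
      by (rule truncated_triangle_realises[OF S d k0 _ _ _ kd r0 _ _ eq]) (use k1 d dr in auto)
  qed
qed

end

lemma triangle_is_gauge:
  fixes a b c :: "real^2"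
  assumes "\<not> collinear {a, b, c}"
  shows "convex hull {a, b, c} \<in> gauges"
proof -
  have "aff_dim {a, b, c} \<ge> 2" using assms by (simp add: collinear_aff_dim)
  moreover have "aff_dim {a, b, c} \<le> 2" using aff_dim_le_DIM[of "{a, b, c}"] by simp
  ultimately have "aff_dim (convex hull {a, b, c}) = 2" by (simp add: aff_dim_convex_hull)
  moreover have "compact (convex hull {a, b, c})" by (simp add: compact_convex_hull finite_imp_compact)
  ultimately show ?thesis by (simp add: gauges_def convex_bodies_def)
qed

text \<open>
  Cramer's rule for the basis \<open>b - a\<close>, \<open>c - a\<close>.
\<close>

lemma barycentric_exists:
  fixes a b c :: "real^2"
  assumes "\<not> collinear {a, b, c}"
  shows "\<exists>n1 n2 n3 k1 k2 k3. barycentric a b c n1 n2 n3 k1 k2 k3"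
proof -
  define p q where "p = b - a" "q = c - a"
  note pq = p_q_def
  have "collinear {a, b, c} = collinear {0, p, q}"
    using collinear_3[of b a c] by (simp add: pq insert_commute)
  then have D0: "p$1 * q$2 - p$2 * q$1 \<noteq> 0" using assms cross_noncollinear by blast
  define D where "D = p$1 * q$2 - p$2 * q$1"
  define n2 n3 :: "real^2" where "n2 = vector [q$2 / D, - q$1 / D]" "n3 = vector [- p$2 / D, p$1 / D]"
  note n_defs = n2_n3_def
  have D: "D \<noteq> 0" using D0 by (simp add: D_def)
  have n2: "n2 \<bullet> x = (x$1 * q$2 - x$2 * q$1) / D" and n3: "n3 \<bullet> x = (p$1 * x$2 - p$2 * x$1) / D" for x
    unfolding n_defs by (simp_all add: inner_vec_def sum_2 diff_divide_distrib mult.commute)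
  have pq_coords: "n2 \<bullet> p = 1" "n2 \<bullet> q = 0" "n3 \<bullet> p = 0" "n3 \<bullet> q = 1"
    unfolding n2 n3 using D by (simp_all add: D_def mult.commute)
  have span: "x = (n2 \<bullet> x) *\<^sub>R p + (n3 \<bullet> x) *\<^sub>R q" for x
  proof -
    have "D * x$1 = (x$1 * q$2 - x$2 * q$1) * p$1 + (p$1 * x$2 - p$2 * x$1) * q$1"
      "D * x$2 = (x$1 * q$2 - x$2 * q$1) * p$2 + (p$1 * x$2 - p$2 * x$1) * q$2"
      unfolding D_def by (simp_all add: algebra_simps)
    then have "x$1 = ((x$1 * q$2 - x$2 * q$1) * p$1 + (p$1 * x$2 - p$2 * x$1) * q$1) / D"
      "x$2 = ((x$1 * q$2 - x$2 * q$1) * p$2 + (p$1 * x$2 - p$2 * x$1) * q$2) / D"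
      using D by (metis nonzero_mult_div_cancel_left)+
    then show ?thesis unfolding n2 n3 by (simp add: vec_eq_iff forall_2 add_divide_distrib)
  qed
  have b: "b = a + p" and c: "c = a + q" by (simp_all add: pq)
  have "barycentric a b c (- n2 - n3) n2 n3 (1 + n2 \<bullet> a + n3 \<bullet> a) (- (n2 \<bullet> a)) (- (n3 \<bullet> a))"
  proof
    fix x :: "real^2"
    have "x = a + (x - a)" by simp
    also have "\<dots> = a + ((n2 \<bullet> (x - a)) *\<^sub>R p + (n3 \<bullet> (x - a)) *\<^sub>R q)"
      using span[of "x - a"] by simp
    also have "\<dots> = ((- n2 - n3) \<bullet> x + (1 + n2 \<bullet> a + n3 \<bullet> a)) *\<^sub>R a + (n2 \<bullet> x + - (n2 \<bullet> a)) *\<^sub>R b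
        + (n3 \<bullet> x + - (n3 \<bullet> a)) *\<^sub>R c"
      unfolding b c by (simp add: inner_diff_right inner_diff_left algebra_simps)
    finally show "x = ((- n2 - n3) \<bullet> x + (1 + n2 \<bullet> a + n3 \<bullet> a)) *\<^sub>R a + (n2 \<bullet> x + - (n2 \<bullet> a)) *\<^sub>R b
        + (n3 \<bullet> x + - (n3 \<bullet> a)) *\<^sub>R c" .
  qed (simp_all add: b c inner_add_right inner_diff_left pq_coords)
  then show ?thesis by blast
qed

section \<open>Contact points of an optimal containment\<close>

lemma in_compact_convex_if_support:
  fixes C :: "'a::euclidean_space set"
  assumes "convex C" "compact C" "C \<noteq> {}"
    and sup: "\<And>u. norm u = 1 \<Longrightarrow> \<exists>c\<in>C. u \<bullet> y \<le> u \<bullet> c"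
  shows "y \<in> C"
proof (rule ccontr)
  assume "y \<notin> C"
  then obtain a b where ab: "a \<bullet> y < b" "\<forall>x\<in>C. b < a \<bullet> x"
    using separating_hyperplane_closed_point[OF assms(1) compact_imp_closed[OF assms(2)]] by blast
  obtain x where "x \<in> C" using assms(3) by blast
  then have "a \<bullet> y < a \<bullet> x" using ab by (meson order_less_trans)
  then have "a \<noteq> 0" by (rule contrapos_pn) simp
  define u where "u = (- 1 / norm a) *\<^sub>R a"
  have "norm u = 1" using \<open>a \<noteq> 0\<close> by (simp add: u_def)
  then obtain c where "c \<in> C" "u \<bullet> y \<le> u \<bullet> c" using sup by blast
  then have "a \<bullet> c \<le> a \<bullet> y" using \<open>a \<noteq> 0\<close> by (simp add: u_def field_simps)
  moreover have "a \<bullet> y < a \<bullet> c" using ab \<open>c \<in> C\<close> by (meson order_less_trans)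
  ultimately show False by simp
qed

text \<open>
  Every point of \<open>C\<close> has norm at most \<open>B\<close>, so scaling the translate of \<open>K\<close> by \<open>1 + b / B\<close> moves its
  points by at most \<open>b\<close> and keeps them inside \<open>C\<close>.
\<close>

lemma shrink_if_neighbourhood:
  fixes C :: "'a::euclidean_space set"
  assumes C: "compact C" and "b > 0"
    and sub: "\<And>x w. x \<in> K \<Longrightarrow> norm w \<le> b \<Longrightarrow> t + x + w \<in> C"
  shows "\<exists>l. 0 \<le> l \<and> l < 1 \<and> (\<lambda>x. t + x) ` K \<subseteq> (\<lambda>x. l *\<^sub>R x) ` C"
proof -
  obtain B where B: "B > 0" "\<And>x. x \<in> C \<Longrightarrow> norm x \<le> B"
    using C compact_imp_bounded bounded_pos by metis
  define l where "l = 1 / (1 + b / B)"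
  have l: "0 < l" "l < 1" "1 / l = 1 + b / B" using B \<open>b > 0\<close> by (auto simp: l_def field_simps add_pos_pos)
  have "t + x \<in> (\<lambda>x. l *\<^sub>R x) ` C" if "x \<in> K" for x
  proof
    have tx: "t + x \<in> C" using sub[OF that, of 0] \<open>b > 0\<close> by simp
    have "norm ((b / B) *\<^sub>R (t + x)) \<le> (b / B) * B"
      unfolding norm_scaleR using B(1) B(2)[OF tx] \<open>b > 0\<close> by (intro mult_mono) auto
    then have "t + x + (b / B) *\<^sub>R (t + x) \<in> C" using sub[OF that] B by simp
    then show "(1 / l) *\<^sub>R (t + x) \<in> C" unfolding l(3) by (simp add: scaleR_left_distrib)
    show "t + x = l *\<^sub>R (1 / l) *\<^sub>R (t + x)" using l(1) by simp
  qed
  then show ?thesis using l by (intro exI[of _ l]) auto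
qed

text \<open>
  Let \<open>h\<^sub>C\<close> and \<open>h\<^sub>K\<close> be the support functions. The point \<open>(0, 0)\<close> lies in the convex hull of the
  pairs \<open>(u, s)\<close> with \<open>u\<close> a unit vector and \<open>s \<ge> h\<^sub>C u - h\<^sub>K u\<close>. Otherwise a strictly separating linear
  functional, which must be positive in the direction of \<open>s\<close>, translates into a vector \<open>t\<close> with
  \<open>h\<^sub>K u + u \<bullet> t < h\<^sub>C u\<close>, uniformly in \<open>u\<close>; then \<open>t + K\<close> lies in the interior of \<open>C\<close>, and \<open>K\<close> fits into a
  smaller copy. Since \<open>K \<subseteq> C\<close> makes all the numbers \<open>s\<close> nonnegative, a convex combination equal to
  \<open>(0, 0)\<close> uses only directions with \<open>s = 0\<close>, and these are the common normals.
\<close>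

lemma optimal_containment_normals:
  fixes K C :: "'a::euclidean_space set"
  assumes K: "compact K" "K \<noteq> {}" and C: "compact C" "convex C" and KC: "K \<subseteq> C"
    and opt: "\<And>l t. 0 \<le> l \<Longrightarrow> (\<lambda>x. t + x) ` K \<subseteq> (\<lambda>x. l *\<^sub>R x) ` C \<Longrightarrow> 1 \<le> l"
  shows "0 \<in> convex hull {u. norm u = 1 \<and> (\<exists>p\<in>K. \<forall>c\<in>C. u \<bullet> c \<le> u \<bullet> p)}" (is "0 \<in> convex hull ?Z")
proof -
  have Cne: "C \<noteq> {}" using K KC by auto
  obtain B where B: "B > 0" "\<And>x. x \<in> C \<Longrightarrow> norm x \<le> B"
    using C compact_imp_bounded bounded_pos by metis
  have Bu: "\<bar>u \<bullet> x\<bar> \<le> B" if "norm u = 1" "x \<in> C" for u x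
    using Cauchy_Schwarz_ineq2[of u x] B that by fastforce
  \<comment> \<open>The cut-off at \<open>2*B\<close> makes the set compact; it bounds every difference of support values.\<close>
  define P where "P = (sphere 0 1 \<times> {0..2*B}) \<times> K \<inter> 
    (\<Inter>c\<in>C. {q :: ('a \<times> real) \<times> 'a. fst (fst q) \<bullet> (c - snd q) \<le> snd (fst q)})"
  define A where "A = fst ` P"
  have cP: "compact P" unfolding P_def
    by (intro compact_Int_closed compact_Times compact_sphere compact_Icc K closed_INT ballI
        closed_Collect_le continuous_intros)
  have cA: "compact A" unfolding A_def by (intro compact_continuous_image cP continuous_intros)
  have Aiff: "(u, s) \<in> A \<longleftrightarrow> norm u = 1 \<and> 0 \<le> s \<and> s \<le> 2*B \<and> (\<exists>p\<in>K. \<forall>c\<in>C. u \<bullet> (c - p) \<le> s)" for u s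
  proof -
    have "(u, s) \<in> A \<longleftrightarrow> (\<exists>p. ((u, s), p) \<in> P)" unfolding A_def by force
    then show ?thesis unfolding P_def by auto
  qed
  have chA: "compact (convex hull A)" using cA by (rule compact_convex_hull)
  have "0 \<in> convex hull A"
  proof (rule ccontr)
    assume "0 \<notin> convex hull A"
    then obtain v b where vb: "b > 0" "\<And>x. x \<in> convex hull A \<Longrightarrow> b < v \<bullet> x"
      using separating_hyperplane_closed_0[of "convex hull A"] compact_imp_closed[OF chA] convex_convex_hull
      by (metis UNIV_I)
    have vbA: "b < fst v \<bullet> u + snd v * s" if "(u, s) \<in> A" for u s
      using vb(2)[OF hull_inc[OF that]] by (cases v) simp
    obtain p0 where p0: "p0 \<in> K" using K by auto
    have top: "(u, 2*B) \<in> A" if "norm u = 1" for u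
    proof -
      have "u \<bullet> (c - p0) \<le> 2*B" if "c \<in> C" for c
        using Bu[OF \<open>norm u = 1\<close> that] Bu[OF \<open>norm u = 1\<close>, of p0] p0 KC by (auto simp: inner_diff_right)
      then show ?thesis using that B p0 by (auto simp: Aiff)
    qed
    obtain e :: 'a where "e \<in> Basis" using nonempty_Basis by blast
    then have "norm e = 1" by simp
    then have "b < fst v \<bullet> e + snd v * (2*B)" "b < fst v \<bullet> (-e) + snd v * (2*B)"
      using vbA[OF top, of e] vbA[OF top, of "-e"] by auto
    then have "0 < 2 * snd v * (2*B)" using vb(1) by simp
    then have v2: "snd v > 0" using B by (simp add: zero_less_mult_iff)
    define t where "t = - (1 / snd v) *\<^sub>R fst v"
    have "t + x + w \<in> C" if x: "x \<in> K" and w: "norm w \<le> b / snd v" for x w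
    proof (rule in_compact_convex_if_support[OF C(2,1) Cne])
      fix u :: 'a assume u: "norm u = 1"
      obtain c where c: "c \<in> C" "\<And>c'. c' \<in> C \<Longrightarrow> u \<bullet> c' \<le> u \<bullet> c"
        using continuous_attains_sup[OF C(1) Cne, of "\<lambda>c. u \<bullet> c"] continuous_on_inner[OF continuous_on_const continuous_on_id]
        by metis
      have "(u, u \<bullet> (c - x)) \<in> A"
        using u c(2)[of x] x KC Bu[OF u c(1)] Bu[OF u, of x] c by (auto simp: Aiff inner_diff_right intro!: bexI[of _ x])
      from vbA[OF this] have "b / snd v < (1 / snd v) * (fst v \<bullet> u) + u \<bullet> (c - x)"
        using v2 by (simp add: field_simps)
      moreover have "u \<bullet> w \<le> b / snd v" using norm_cauchy_schwarz[of u w] u w by simp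
      ultimately have "u \<bullet> (t + x + w) \<le> u \<bullet> c"
        by (simp add: t_def inner_diff_right inner_add_right inner_commute)
      then show "\<exists>c\<in>C. u \<bullet> (t + x + w) \<le> u \<bullet> c" using c by blast
    qed
    then obtain l where "0 \<le> l" "l < 1" "(\<lambda>x. t + x) ` K \<subseteq> (\<lambda>x. l *\<^sub>R x) ` C"
      using shrink_if_neighbourhood[OF C(1), of "b / snd v" K t] vb v2 by auto
    then show False using opt by fastforce
  qed
  then obtain F \<mu> where F: "finite F" "F \<subseteq> A" "\<And>x. x \<in> F \<Longrightarrow> 0 \<le> \<mu> x" "sum \<mu> F = 1" "(\<Sum>x\<in>F. \<mu> x *\<^sub>R x) = 0"
    unfolding convex_hull_explicit by blast
  have F1: "(\<Sum>x\<in>F. \<mu> x *\<^sub>R fst x) = 0" "(\<Sum>x\<in>F. \<mu> x * snd x) = 0"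
    using arg_cong[OF F(5), of fst] arg_cong[OF F(5), of snd] by (simp_all add: fst_sum snd_sum)
  have s0: "0 \<le> \<mu> x * snd x" if "x \<in> F" for x
    using F(2) F(3)[OF that] that Aiff[of "fst x" "snd x"] by (intro mult_nonneg_nonneg) auto
  have "\<mu> x = 0 \<or> fst x \<in> ?Z" if "x \<in> F" for x
  proof -
    have "\<mu> x * snd x = 0" using F1(2) s0 F(1) that by (simp add: sum_nonneg_eq_0_iff)
    moreover have "(fst x, snd x) \<in> A" using F(2) \<open>x \<in> F\<close> by auto
    then have "fst x \<in> ?Z" if "snd x = 0"
      unfolding Aiff that by (simp add: inner_diff_right)
    ultimately show ?thesis by auto
  qed
  then have "(\<Sum>x\<in>{x\<in>F. \<mu> x \<noteq> 0}. \<mu> x *\<^sub>R fst x) \<in> convex hull ?Z"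
  proof (intro convex_sum)
    show "sum \<mu> {x \<in> F. \<mu> x \<noteq> 0} = 1" using F(1,4) by (subst sum.mono_neutral_left[of F]) auto
    show "fst x \<in> convex hull ?Z" if "x \<in> {x \<in> F. \<mu> x \<noteq> 0}" for x
      using that \<open>\<And>x. x \<in> F \<Longrightarrow> \<mu> x = 0 \<or> fst x \<in> ?Z\<close>[of x] by (intro hull_inc) blast
  qed (use F(1,3) in auto)
  also have "(\<Sum>x\<in>{x\<in>F. \<mu> x \<noteq> 0}. \<mu> x *\<^sub>R fst x) = (\<Sum>x\<in>F. \<mu> x *\<^sub>R fst x)"
    using F(1) by (intro sum.mono_neutral_left) auto
  finally show ?thesis using F1 by simp
qed

text \<open>
  By Caratheodory's theorem three of the common normals suffice in the plane. Their weights are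
  absorbed into the vectors, and repetitions and zero vectors are admitted so that there are always
  exactly three.
\<close>

lemma optimal_containment_plane:
  fixes K C :: "(real^2) set"
  assumes K: "compact K" "K \<noteq> {}" and C: "compact C" "convex C" and KC: "K \<subseteq> C"
    and opt: "\<And>l t. 0 \<le> l \<Longrightarrow> (\<lambda>x. t + x) ` K \<subseteq> (\<lambda>x. l *\<^sub>R x) ` C \<Longrightarrow> 1 \<le> l"
  shows "\<exists>a1 a2 a3 p1 p2 p3. a1 + a2 + a3 = 0 \<and> (a1 \<noteq> 0 \<or> a2 \<noteq> 0 \<or> a3 \<noteq> 0) \<and>
    p1 \<in> K \<and> p2 \<in> K \<and> p3 \<in> K \<and> (\<forall>c\<in>C. a1 \<bullet> c \<le> a1 \<bullet> p1) \<and>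
    (\<forall>c\<in>C. a2 \<bullet> c \<le> a2 \<bullet> p2) \<and> (\<forall>c\<in>C. a3 \<bullet> c \<le> a3 \<bullet> p3)"
proof -
  let ?Z = "{u. norm u = 1 \<and> (\<exists>p\<in>K. \<forall>c\<in>C. u \<bullet> c \<le> u \<bullet> p)}"
  have "0 \<in> convex hull ?Z" by (rule optimal_containment_normals[OF assms])
  then obtain F where F: "finite F" "F \<subseteq> ?Z" "card F \<le> 3" "0 \<in> convex hull F"
    using caratheodory[of ?Z] by auto
  have Fne: "F \<noteq> {}" using F(4) by auto
  have "\<exists>x y z. F = {x, y, z}"
  proof -
    consider "card F = 1" | "card F = 2" | "card F = 3"
      using F(1,3) Fne card_gt_0_iff[of F] by linarith
    then show ?thesis
    proof cases
      case 1 then show ?thesis by (auto simp: card_1_singleton_iff)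
    next
      case 2 then show ?thesis by (metis card_2_iff insert_absorb2)
    next
      case 3 then show ?thesis by (metis card_3_iff)
    qed
  qed
  then obtain x y z where xyz: "F = {x, y, z}" by blast
  from F(4) obtain u v w where uvw: "0 = u *\<^sub>R x + v *\<^sub>R y + w *\<^sub>R z" "0 \<le> u" "0 \<le> v" "0 \<le> w" "u + v + w = 1"
    unfolding xyz convex_hull_3 by blast
  have n: "norm x = 1" "norm y = 1" "norm z = 1" using F(2) xyz by auto
  have Z: "x \<in> ?Z" "y \<in> ?Z" "z \<in> ?Z" using F(2) xyz by auto
  from Z(1) obtain p1 where p1: "p1 \<in> K" "\<forall>c\<in>C. x \<bullet> c \<le> x \<bullet> p1" by blast
  from Z(2) obtain p2 where p2: "p2 \<in> K" "\<forall>c\<in>C. y \<bullet> c \<le> y \<bullet> p2" by blast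
  from Z(3) obtain p3 where p3: "p3 \<in> K" "\<forall>c\<in>C. z \<bullet> c \<le> z \<bullet> p3" by blast
  have "x \<noteq> 0" "y \<noteq> 0" "z \<noteq> 0" using n by auto
  moreover have "u \<noteq> 0 \<or> v \<noteq> 0 \<or> w \<noteq> 0" using uvw(5) by linarith
  ultimately have ne: "u *\<^sub>R x \<noteq> 0 \<or> v *\<^sub>R y \<noteq> 0 \<or> w *\<^sub>R z \<noteq> 0" by simp
  have m1: "\<forall>c\<in>C. (u *\<^sub>R x) \<bullet> c \<le> (u *\<^sub>R x) \<bullet> p1" using uvw(2) p1(2) by (simp add: mult_left_mono)
  have m2: "\<forall>c\<in>C. (v *\<^sub>R y) \<bullet> c \<le> (v *\<^sub>R y) \<bullet> p2" using uvw(3) p2(2) by (simp add: mult_left_mono)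
  have m3: "\<forall>c\<in>C. (w *\<^sub>R z) \<bullet> c \<le> (w *\<^sub>R z) \<bullet> p3" using uvw(4) p3(2) by (simp add: mult_left_mono)
  show ?thesis
    by (intro exI conjI) (rule uvw(1)[symmetric] ne p1(1) p2(1) p3(1) m1 m2 m3)+
qed

section \<open>The upper bound for the inradius\<close>

text \<open>
  The sum of the support values is the common denominator of the barycentric coordinates used below.
  It vanishes only if every \<open>a\<^sub>i\<close> is constant on \<open>C\<close>, which the ball in \<open>C\<close> excludes.
\<close>

lemma contact_sum_pos:
  fixes C :: "(real^2) set"
  assumes ball: "e > 0" "cball c0 e \<subseteq> C"
    and a: "a1 + a2 + a3 = 0" "a1 \<noteq> 0 \<or> a2 \<noteq> 0 \<or> a3 \<noteq> 0"
    and h: "\<And>c. c \<in> C \<Longrightarrow> a1 \<bullet> c \<le> h1" "\<And>c. c \<in> C \<Longrightarrow> a2 \<bullet> c \<le> h2" "\<And>c. c \<in> C \<Longrightarrow> a3 \<bullet> c \<le> h3"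
  shows "h1 + h2 + h3 > 0"
proof -
  have strict: "b \<bullet> c0 < h" if "b \<noteq> 0" "\<And>c. c \<in> C \<Longrightarrow> b \<bullet> c \<le> h" for b :: "real^2" and h
  proof -
    have "c0 + (e / norm b) *\<^sub>R b \<in> C" using ball that(1) by (auto simp: dist_norm)
    then have "b \<bullet> c0 + (e / norm b) * (b \<bullet> b) \<le> h" using that(2) by (fastforce simp: inner_add_right)
    moreover have "(e / norm b) * (b \<bullet> b) > 0" using ball that(1) by simp
    ultimately show ?thesis by linarith
  qed
  have c0: "c0 \<in> C" using ball by auto
  have s: "a1 \<bullet> c0 + a2 \<bullet> c0 + a3 \<bullet> c0 = 0" using a(1) by (metis inner_add_left inner_zero_left)
  from a(2) consider "a1 \<bullet> c0 < h1" | "a2 \<bullet> c0 < h2" | "a3 \<bullet> c0 < h3" using strict h by blast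
  then show ?thesis using s h[OF c0] by cases auto
qed

text \<open>
  Let \<open>H\<close> be the sum of the support values of \<open>C\<close> in the directions \<open>a\<^sub>i\<close>, which are also those of \<open>K\<close>,
  and let \<open>G\<close> be the sum of those in the opposite directions. As \<open>K\<close> contains a translate of \<open>r C\<close>, the
  three widths of \<open>K\<close> add up to at least \<open>H + r G\<close>, and they add up to at most \<open>d (H + G)\<close>. Since
  \<open>- a\<^sub>i\<close> is the sum of the other two vectors, \<open>G \<le> 2 H\<close>, and the estimate is weakest when \<open>G = 2 H\<close>,
  that is, when \<open>C\<close> is the triangle.
\<close>

lemma inradius_diameter_inequality:
  fixes K C :: "(real^2) set"
  assumes C: "compact C" and ball: "e > 0" "cball c0 e \<subseteq> C"
    and a: "a1 + a2 + a3 = 0" "a1 \<noteq> 0 \<or> a2 \<noteq> 0 \<or> a3 \<noteq> 0"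
    and p: "p1 \<in> K" "p2 \<in> K" "p3 \<in> K" and KC: "K \<subseteq> C"
    and h: "\<And>c. c \<in> C \<Longrightarrow> a1 \<bullet> c \<le> a1 \<bullet> p1" "\<And>c. c \<in> C \<Longrightarrow> a2 \<bullet> c \<le> a2 \<bullet> p2"
       "\<And>c. c \<in> C \<Longrightarrow> a3 \<bullet> c \<le> a3 \<bullet> p3"
    and r: "\<And>c. c \<in> C \<Longrightarrow> r *\<^sub>R c + t \<in> K"
    and d: "\<And>x y. x \<in> K \<Longrightarrow> y \<in> K \<Longrightarrow> \<exists>c\<in>C. \<exists>c'\<in>C. x - y = d *\<^sub>R (c - c')" "0 \<le> d"
  shows "1 + 2 * r \<le> 3 * d"
proof -
  let ?h1 = "a1 \<bullet> p1" and ?h2 = "a2 \<bullet> p2" and ?h3 = "a3 \<bullet> p3"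
  define H where "H = ?h1 + ?h2 + ?h3"
  have H: "H > 0" unfolding H_def by (rule contact_sum_pos[OF ball a h])
  have Cne: "C \<noteq> {}" using ball by force
  have zero: "a1 \<bullet> x + a2 \<bullet> x + a3 \<bullet> x = 0" for x using a(1) by (metis inner_add_left inner_zero_left)
  \<comment> \<open>For each normal, \<open>g\<close> is the support value of \<open>C\<close> in the opposite direction.\<close>
  have one: "\<exists>g. b \<bullet> q + r * g - b \<bullet> t \<le> d * (b \<bullet> q + g) \<and> r * (b \<bullet> q + g) \<le> d * (b \<bullet> q + g)
       \<and> (\<forall>c\<in>C. - (b \<bullet> c) \<le> g) \<and> (\<exists>c\<in>C. g = - (b \<bullet> c))"
    if q: "q \<in> K" "\<And>c. c \<in> C \<Longrightarrow> b \<bullet> c \<le> b \<bullet> q" for b q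
  proof -
    obtain m where m: "m \<in> C" "\<And>c. c \<in> C \<Longrightarrow> b \<bullet> m \<le> b \<bullet> c"
      using continuous_attains_inf[OF C Cne, of "\<lambda>c. b \<bullet> c"] continuous_on_inner[OF continuous_on_const continuous_on_id]
      by metis
    have w: "b \<bullet> (x - y) \<le> d * (b \<bullet> q - b \<bullet> m)" if xy: "x \<in> K" "y \<in> K" for x y
    proof -
      obtain c c' where "c \<in> C" "c' \<in> C" "x - y = d *\<^sub>R (c - c')" using d(1)[OF xy] by blast
      moreover then have "b \<bullet> c - b \<bullet> c' \<le> b \<bullet> q - b \<bullet> m" using m q by fastforce
      ultimately show ?thesis using d(2) by (simp add: inner_diff_right mult_left_mono)
    qed
    have "b \<bullet> (q - (r *\<^sub>R m + t)) \<le> d * (b \<bullet> q - b \<bullet> m)" using w q r m by blast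
    moreover have "b \<bullet> ((r *\<^sub>R q + t) - (r *\<^sub>R m + t)) \<le> d * (b \<bullet> q - b \<bullet> m)"
      using w q(1) r m KC by blast
    ultimately show ?thesis
      using m by (intro exI[of _ "- (b \<bullet> m)"]) (auto simp: inner_diff_right inner_add_right algebra_simps)
  qed
  obtain g1 where g1: "?h1 + r * g1 - a1 \<bullet> t \<le> d * (?h1 + g1)" "r * (?h1 + g1) \<le> d * (?h1 + g1)"
    "\<exists>c\<in>C. g1 = - (a1 \<bullet> c)" "\<forall>c\<in>C. - (a1 \<bullet> c) \<le> g1" using one[OF p(1) h(1)] by blast
  obtain g2 where g2: "?h2 + r * g2 - a2 \<bullet> t \<le> d * (?h2 + g2)" "r * (?h2 + g2) \<le> d * (?h2 + g2)"
    "\<exists>c\<in>C. g2 = - (a2 \<bullet> c)" "\<forall>c\<in>C. - (a2 \<bullet> c) \<le> g2" using one[OF p(2) h(2)] by blast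
  obtain g3 where g3: "?h3 + r * g3 - a3 \<bullet> t \<le> d * (?h3 + g3)" "r * (?h3 + g3) \<le> d * (?h3 + g3)"
    "\<exists>c\<in>C. g3 = - (a3 \<bullet> c)" "\<forall>c\<in>C. - (a3 \<bullet> c) \<le> g3" using one[OF p(3) h(3)] by blast
  define G where "G = g1 + g2 + g3"
  have c0: "c0 \<in> C" using ball by auto
  have G0: "G \<ge> 0" using g1(4) g2(4) g3(4) c0 zero[of c0] unfolding G_def by fastforce
  have "g1 \<le> ?h2 + ?h3"
  proof -
    obtain c where "c \<in> C" "g1 = - (a1 \<bullet> c)" using g1(3) by blast
    then show ?thesis using h(2)[of c] h(3)[of c] zero[of c] by linarith
  qed
  moreover have "g2 \<le> ?h1 + ?h3"
  proof -
    obtain c where "c \<in> C" "g2 = - (a2 \<bullet> c)" using g2(3) by blast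
    then show ?thesis using h(1)[of c] h(3)[of c] zero[of c] by linarith
  qed
  moreover have "g3 \<le> ?h1 + ?h2"
  proof -
    obtain c where "c \<in> C" "g3 = - (a3 \<bullet> c)" using g3(3) by blast
    then show ?thesis using h(1)[of c] h(2)[of c] zero[of c] by linarith
  qed
  ultimately have GH: "G \<le> 2 * H" by (simp add: G_def H_def)
  have 1: "H + r * G \<le> d * (H + G)"
    using g1(1) g2(1) g3(1) zero[of t] unfolding G_def H_def by (simp add: algebra_simps)
  have "r * (H + G) \<le> d * (H + G)"
    using g1(2) g2(2) g3(2) unfolding G_def H_def by (simp add: algebra_simps)
  then have "r \<le> d" using H G0 by simp
  then have "G * (d - r) \<le> 2 * H * (d - r)" using GH by (intro mult_right_mono) auto
  with 1 have "H * (1 + 2 * r) \<le> H * (3 * d)" by (simp add: algebra_simps)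
  then show ?thesis using H by simp
qed

section \<open>The lower bound for the inradius\<close>

text \<open>
  The right-hand side is affine in each variable, so its minimum over the cube is attained at a
  vertex. At a vertex with equal coordinates the value is \<open>d\<^sup>3 + (1 - d)\<^sup>3\<close>, which exceeds \<open>d (1 - d)\<close> by
  \<open>(2 d - 1)\<^sup>2\<close>; at every other vertex it is exactly \<open>d (1 - d)\<close>.
\<close>

lemma multiaffine_lower_bound:
  fixes d x y z :: real
  assumes "x \<le> d" "1 - x \<le> d" "y \<le> d" "1 - y \<le> d" "z \<le> d" "1 - z \<le> d"
  shows "d * (1 - d) \<le> x * y * z + (1 - x) * (1 - y) * (1 - z)"
proof -
  have interp: "k \<le> b * x + c * (1 - x)" if "x \<le> d" "1 - x \<le> d" "k \<le> b * d + c * (1 - d)" "k \<le> b * (1 - d) + c * d"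
    for k b c x :: real
  proof (cases "b \<le> c")
    case True
    then have "(c - b) * x \<le> (c - b) * d" using that by (intro mult_left_mono) auto
    then show ?thesis using that by (simp add: algebra_simps)
  next
    case False
    then have "(b - c) * (1 - d) \<le> (b - c) * x" using that by (intro mult_left_mono) auto
    then show ?thesis using that by (simp add: algebra_simps)
  qed
  have cube: "d * (1 - d) \<le> d * d * d + (1 - d) * (1 - d) * (1 - d)"
  proof -
    have "0 \<le> (2 * d - 1)^2" by simp
    then show ?thesis by (simp add: power2_eq_square algebra_simps)
  qed
  define P where "P b c w \<longleftrightarrow> d * (1 - d) \<le> b * c * w + (1 - b) * (1 - c) * (1 - w)" for b c w
  have three: "P d d z" "P d (1 - d) z" "P (1 - d) d z" "P (1 - d) (1 - d) z"
    unfolding P_def by (rule interp[OF assms(5,6)]; use cube in \<open>simp add: algebra_simps\<close>)+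
  have two: "P b y z" if "P b d z" "P b (1 - d) z" for b
    using interp[OF assms(3,4), of "d * (1 - d)" "b * z" "(1 - b) * (1 - z)"] that
    unfolding P_def by (simp add: algebra_simps)
  have "P d y z" "P (1 - d) y z" using two three by blast+
  then show ?thesis
    using interp[OF assms(1,2), of "d * (1 - d)" "y * z" "(1 - y) * (1 - z)"]
    unfolding P_def by (simp add: algebra_simps)
qed

lemma independent_functionals_plane:
  fixes a b z :: "real^2"
  assumes "\<And>\<alpha> \<beta>. \<alpha> *\<^sub>R a + \<beta> *\<^sub>R b = 0 \<Longrightarrow> \<alpha> = 0 \<and> \<beta> = 0"
    and "a \<bullet> z = 0" "b \<bullet> z = 0"
  shows "z = 0"
proof -
  let ?D = "a$1 * b$2 - a$2 * b$1"
  have D: "?D \<noteq> 0"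
  proof
    assume 0: "?D = 0"
    have "(b$1) *\<^sub>R a + (- (a$1)) *\<^sub>R b = 0" "(b$2) *\<^sub>R a + (- (a$2)) *\<^sub>R b = 0"
      using 0 by (simp_all add: vec_eq_iff forall_2 mult.commute)
    then have "a$1 = 0" "a$2 = 0" using assms(1)[of "b$1" "- (a$1)"] assms(1)[of "b$2" "- (a$2)"] by simp_all
    then have "a = 0" by (simp add: vec_eq_iff forall_2)
    then show False using assms(1)[of 1 0] by simp
  qed
  have e: "a$1 * z$1 + a$2 * z$2 = 0" "b$1 * z$1 + b$2 * z$2 = 0"
    using assms(2,3) by (simp_all add: inner_vec_def sum_2)
  have "?D * z$1 = 0" "?D * z$2 = 0" using e by algebra+
  then show ?thesis using D by (simp add: vec_eq_iff forall_2)
qed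

text \<open>
  For \<open>d < 1\<close>, the functions \<open>L1\<close>, \<open>L2\<close>, \<open>L3\<close> in the proof are the barycentric coordinates of the triangle formed
  by the supporting lines. They are nonnegative on \<open>C\<close>, hence vary by at most \<open>1\<close> on \<open>C\<close> and by at most
  \<open>d\<close> on \<open>K\<close>. The touching points have coordinates \<open>p1 = (0, x, 1 - x)\<close>, \<open>p2 = (1 - y, 0, y)\<close>,
  \<open>p3 = (z, 1 - z, 0)\<close>. Let \<open>q1\<close> divide the side \<open>p2 p3\<close> in the reverse of the ratio in which \<open>p1\<close> divides
  the edge \<open>e\<^sub>2 e\<^sub>3\<close>, and define \<open>q2\<close> and \<open>q3\<close> likewise. With \<open>r = x y z + (1 - x) (1 - y) (1 - z)\<close>, the points
  \<open>q1\<close>, \<open>q2\<close>, \<open>q3\<close> have the coordinates \<open>m + r e\<^sub>i\<close> for one and the same \<open>m\<close>, so they are the vertices of a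
  copy of the large triangle with ratio \<open>r\<close>. The affine map \<open>Q\<close> that sends the vertices of the large
  triangle to the points \<open>q\<^sub>i\<close> is therefore scaling by \<open>r\<close> followed by a translation, and it maps \<open>C\<close> into
  \<open>K\<close>.
\<close>

lemma inscribed_copy:
  fixes K C :: "(real^2) set"
  assumes K: "convex K" and ball: "e > 0" "cball c0 e \<subseteq> C"
    and a: "a1 + a2 + a3 = 0" "a1 \<noteq> 0 \<or> a2 \<noteq> 0 \<or> a3 \<noteq> 0"
    and p: "p1 \<in> K" "p2 \<in> K" "p3 \<in> K" and KC: "K \<subseteq> C"
    and h: "\<And>c. c \<in> C \<Longrightarrow> a1 \<bullet> c \<le> a1 \<bullet> p1" "\<And>c. c \<in> C \<Longrightarrow> a2 \<bullet> c \<le> a2 \<bullet> p2"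
       "\<And>c. c \<in> C \<Longrightarrow> a3 \<bullet> c \<le> a3 \<bullet> p3"
    and d: "\<And>x y. x \<in> K \<Longrightarrow> y \<in> K \<Longrightarrow> \<exists>c\<in>C. \<exists>c'\<in>C. x - y = d *\<^sub>R (c - c')" "0 \<le> d" "d \<le> 1"
  shows "1 / 2 \<le> d" and "\<exists>r t. d * (1 - d) \<le> r \<and> 0 \<le> r \<and> (\<forall>c\<in>C. r *\<^sub>R c + t \<in> K)"
proof -
  define H where "H = a1 \<bullet> p1 + a2 \<bullet> p2 + a3 \<bullet> p3"
  have H: "H > 0" unfolding H_def by (rule contact_sum_pos[OF ball a h])
  define L1 L2 L3 where "L1 x = (a1 \<bullet> p1 - a1 \<bullet> x) / H" "L2 x = (a2 \<bullet> p2 - a2 \<bullet> x) / H"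
    "L3 x = (a3 \<bullet> p3 - a3 \<bullet> x) / H" for x
  note L_defs = L1_L2_L3_def
  have zero: "a1 \<bullet> x + a2 \<bullet> x + a3 \<bullet> x = 0" for x using a(1) by (metis inner_add_left inner_zero_left)
  have Lsum: "L1 x + L2 x + L3 x = 1" for x
  proof -
    have "L1 x + L2 x + L3 x = ((a1 \<bullet> p1 - a1 \<bullet> x) + (a2 \<bullet> p2 - a2 \<bullet> x) + (a3 \<bullet> p3 - a3 \<bullet> x)) / H"
      unfolding L_defs by (simp only: add_divide_distrib)
    also have "(a1 \<bullet> p1 - a1 \<bullet> x) + (a2 \<bullet> p2 - a2 \<bullet> x) + (a3 \<bullet> p3 - a3 \<bullet> x) = H"
      using zero[of x] unfolding H_def by linarith
    finally show ?thesis using H by simp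
  qed
  have Lpos: "0 \<le> L1 c" "0 \<le> L2 c" "0 \<le> L3 c" if "c \<in> C" for c
    using h[OF that] H by (auto simp: L_defs)
  have Lle: "L1 c \<le> 1" "L2 c \<le> 1" "L3 c \<le> 1" if "c \<in> C" for c
    using Lpos[OF that] Lsum[of c] by linarith+
  have Lp: "L1 p1 = 0" "L2 p2 = 0" "L3 p3 = 0" by (auto simp: L_defs)
  have diff: "L1 x - L1 y \<le> d \<and> L2 x - L2 y \<le> d \<and> L3 x - L3 y \<le> d" if xy: "x \<in> K" "y \<in> K" for x y
  proof -
    obtain c c' where c: "c \<in> C" "c' \<in> C" "x - y = d *\<^sub>R (c - c')" using d(1)[OF xy] by blast
    have "L1 x - L1 y = d * (L1 c - L1 c') \<and> L2 x - L2 y = d * (L2 c - L2 c') \<and> L3 x - L3 y = d * (L3 c - L3 c')"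
    proof -
      have "b \<bullet> x - b \<bullet> y = d * (b \<bullet> c - b \<bullet> c')" for b using c(3) by (metis inner_diff_right inner_scaleR_right)
      then have "(b \<bullet> y - b \<bullet> x) / H = d * ((b \<bullet> c' - b \<bullet> c) / H)" for b
        by (metis minus_diff_eq mult_minus_right times_divide_eq_right)
      then show ?thesis unfolding L_defs by (simp add: diff_divide_distrib[symmetric])
    qed
    then show ?thesis
      using Lpos[OF c(1)] Lpos[OF c(2)] Lle[OF c(1)] Lle[OF c(2)] d(2)
        mult_left_mono[of "L1 c - L1 c'" 1 d] mult_left_mono[of "L2 c - L2 c'" 1 d] mult_left_mono[of "L3 c - L3 c'" 1 d]
      by auto
  qed
  have Ld: "L1 x \<le> d" "L2 x \<le> d" "L3 x \<le> d" if "x \<in> K" for x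
    using diff[OF that p(1)] diff[OF that p(2)] diff[OF that p(3)] Lp by auto
  define x y z where "x = L2 p1" "y = L3 p2" "z = L1 p3"
  note xyz_def = x_y_z_def
  have other: "L3 p1 = 1 - x" "L1 p2 = 1 - y" "L2 p3 = 1 - z"
    using Lsum[of p1] Lsum[of p2] Lsum[of p3] Lp by (auto simp: xyz_def)
  note Lvals = Lp other xyz_def[symmetric]
  have xd: "x \<le> d" "1 - x \<le> d" "y \<le> d" "1 - y \<le> d" "z \<le> d" "1 - z \<le> d"
    using Ld[OF p(1)] Ld[OF p(2)] Ld[OF p(3)] other by (auto simp: xyz_def)
  have x01: "0 \<le> x" "x \<le> 1" "0 \<le> y" "y \<le> 1" "0 \<le> z" "z \<le> 1"
    using xd d(3) by linarith+
  show "1 / 2 \<le> d" using xd by linarith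
  show "\<exists>r t. d * (1 - d) \<le> r \<and> 0 \<le> r \<and> (\<forall>c\<in>C. r *\<^sub>R c + t \<in> K)"
  proof (cases "d = 1")
    case True
    then show ?thesis using p(1) by (intro exI[of _ 0] exI[of _ p1]) auto
  next
    case False
    define r where "r = x * y * z + (1 - x) * (1 - y) * (1 - z)"
    have rd: "d * (1 - d) \<le> r" unfolding r_def by (rule multiaffine_lower_bound[OF xd])
    have "0 < d * (1 - d)" using False d(3) \<open>1 / 2 \<le> d\<close> by simp
    then have r0: "r > 0" using rd by linarith
    \<comment> \<open>The determinant of the coordinates of the touching points is \<open>r\<close>. As it is not zero, an affine
      relation between the coordinate functions that holds at the three points is trivial.\<close>
    have indep: "\<alpha> = 0 \<and> \<beta> = 0" if "\<alpha> *\<^sub>R a1 + \<beta> *\<^sub>R a2 = 0" for \<alpha> \<beta>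
    proof -
      define k where "k = (\<alpha> * (a1 \<bullet> p1) + \<beta> * (a2 \<bullet> p2)) / H"
      have "\<alpha> * L1 w + \<beta> * L2 w = k" for w
      proof -
        have "\<alpha> * (a1 \<bullet> w) + \<beta> * (a2 \<bullet> w) = 0" using that by (metis inner_add_left inner_scaleR_left inner_zero_left)
        moreover have "\<alpha> * L1 w + \<beta> * L2 w = k - (\<alpha> * (a1 \<bullet> w) + \<beta> * (a2 \<bullet> w)) / H"
          unfolding L_defs k_def by (simp add: algebra_simps add_divide_distrib diff_divide_distrib)
        ultimately show ?thesis by simp
      qed
      then have e: "\<beta> * x = k" "\<alpha> * (1 - y) = k" "\<alpha> * z + \<beta> * (1 - z) = k"
        using Lvals by (metis add_0 add_0_right mult_zero_right)+
      have "r * \<alpha> = x * (\<alpha> * z + \<beta> * (1 - z)) - (\<beta> * x) * (1 - z) + (\<alpha> * (1 - y)) * (1 - z) - x * (\<alpha> * (1 - y))"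
        "r * \<beta> = (1 - y) * (\<alpha> * z + \<beta> * (1 - z)) - (\<alpha> * (1 - y)) * z + (\<beta> * x) * z - (1 - y) * (\<beta> * x)"
        unfolding r_def by (simp_all add: algebra_simps)
      then have "r * \<alpha> = 0" "r * \<beta> = 0" unfolding e by (simp_all add: algebra_simps)
      then show ?thesis using r0 by simp
    qed
    define q1 q2 q3 where "q1 = (1 - x) *\<^sub>R p2 + x *\<^sub>R p3" "q2 = y *\<^sub>R p1 + (1 - y) *\<^sub>R p3"
      "q3 = (1 - z) *\<^sub>R p1 + z *\<^sub>R p2"
    note q_defs = q1_q2_q3_def
    have qK: "q1 \<in> K" "q2 \<in> K" "q3 \<in> K"
      unfolding q_defs using K p x01 by (auto intro: convexD)
    define Q where "Q c = L1 c *\<^sub>R q1 + L2 c *\<^sub>R q2 + L3 c *\<^sub>R q3" for c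
    have QK: "Q c \<in> K" if "c \<in> C" for c
      using convex_sum[of "{1::nat,2,3}" K "\<lambda>i. if i = 1 then L1 c else if i = 2 then L2 c else L3 c"
          "\<lambda>i. if i = 1 then q1 else if i = 2 then q2 else q3"] K qK Lpos[OF that] Lsum[of c]
      by (simp add: Q_def add.assoc)
    have aL: "a1 \<bullet> c = a1 \<bullet> p1 - H * L1 c" "a2 \<bullet> c = a2 \<bullet> p2 - H * L2 c" for c
      unfolding L_defs using H by auto
    have ap: "a1 \<bullet> p2 = a1 \<bullet> p1 - H * (1 - y)" "a1 \<bullet> p3 = a1 \<bullet> p1 - H * z"
      "a2 \<bullet> p1 = a2 \<bullet> p2 - H * x" "a2 \<bullet> p3 = a2 \<bullet> p2 - H * (1 - z)"
      using aL(1)[of p2] aL(1)[of p3] aL(2)[of p1] aL(2)[of p3] unfolding Lvals by auto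
    have aQ: "a1 \<bullet> (Q c - r *\<^sub>R c) = (a1 \<bullet> p1) * (1 - r) - H * z * (1 - y)"
      "a2 \<bullet> (Q c - r *\<^sub>R c) = (a2 \<bullet> p2) * (1 - r) - H * x * (1 - z)" for c
    proof -
      have "L3 c = 1 - L1 c - L2 c" using Lsum[of c] by simp
      then show "a1 \<bullet> (Q c - r *\<^sub>R c) = (a1 \<bullet> p1) * (1 - r) - H * z * (1 - y)"
        "a2 \<bullet> (Q c - r *\<^sub>R c) = (a2 \<bullet> p2) * (1 - r) - H * x * (1 - z)"
        unfolding Q_def q_defs inner_diff_right inner_add_right inner_scaleR_right aL(1)[of c] aL(2)[of c] ap r_def
        by algebra+
    qed
    define t where "t = Q c0 - r *\<^sub>R c0"
    have "Q c = r *\<^sub>R c + t" for c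
    proof -
      have "a1 \<bullet> ((Q c - r *\<^sub>R c) - t) = 0" "a2 \<bullet> ((Q c - r *\<^sub>R c) - t) = 0"
        unfolding t_def inner_diff_right[of _ "Q c - r *\<^sub>R c"] aQ by auto
      then have "(Q c - r *\<^sub>R c) - t = 0" 
        using independent_functionals_plane[of a1 a2 "(Q c - r *\<^sub>R c) - t"] indep by blast
      then show ?thesis by (simp add: algebra_simps)
    qed
    then show ?thesis using QK r0 rd by (intro exI[of _ r] exI[of _ t]) auto
  qed
qed

section \<open>The ratios of an arbitrary pair\<close>

text \<open>
  The circumradius, the inradius and the diameter scale with \<open>K\<close> and are invariant under translations
  of \<open>K\<close>, so both bounds may be applied to the copy of \<open>K\<close> that is optimally contained in \<open>C\<close>.
\<close>

lemma radii_ratios_in_region: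
  fixes K C :: "(real^2) set"
  assumes K: "K \<in> convex_bodies" "\<not> is_singleton K" and C: "C \<in> gauges"
  shows "radii_ratios K C \<in> radii_region"
proof -
  have Kp: "compact K" "K \<noteq> {}" "convex K" using K by (auto simp: convex_bodies_def)
  have Cp: "compact C" "convex C" using C by (auto simp: gauges_def convex_bodies_def)
  obtain c0 e where ball: "e > 0" "cball c0 e \<subseteq> C" using gauge_contains_ball[OF C] .
  define R r d where "R = circumradius K C" "r = inradius K C" "d = gauge_diameter K C / 2"
  note defs = R_r_d_def
  obtain s where R: "0 \<le> R" and s: "(\<lambda>x. s + x) ` K \<subseteq> (\<lambda>x. R *\<^sub>R x) ` C"
    using circumradius_least(1)[OF Kp(1,2) C] unfolding defs by blast
  obtain t where r: "0 \<le> r" and t: "(\<lambda>x. r *\<^sub>R x) ` C \<subseteq> (\<lambda>x. t + x) ` K"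
    using inradius_greatest(1)[OF Kp(1,2) C] unfolding defs by blast
  have "R \<noteq> 0"
  proof
    assume "R = 0"
    then have "(\<lambda>x. s + x) ` K \<subseteq> {0}" using s by auto
    then have "\<And>x. x \<in> K \<Longrightarrow> x = - s" by (auto simp: add_eq_0_iff2 image_subset_iff)
    then have "K = {- s}" using Kp(2) by auto
    then show False using K(2) by simp
  qed
  then have R0: "R > 0" using R by simp
  have dp: "\<And>x y. x \<in> K \<Longrightarrow> y \<in> K \<Longrightarrow> circumradius {x, y} C \<le> d"
    "\<exists>x\<in>K. \<exists>y\<in>K. d = circumradius {x, y} C"
    using gauge_diameter_attained[OF Kp(1,2) C] unfolding defs by blast+
  have d0: "0 \<le> d" using dp(2) circumradius_pair_attained[OF C] by metis
  have dR: "d \<le> R"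
  proof -
    obtain x y where "x \<in> K" "y \<in> K" "d = circumradius {x, y} C" using dp(2) by blast
    then show ?thesis using circumradius_least(2)[of "{x, y}" C R s] C R s by auto
  qed
  define f where "f x = (1 / R) *\<^sub>R (s + x)" for x
  define K' where "K' = f ` K"
  have K'C: "K' \<subseteq> C"
  proof
    fix y assume "y \<in> K'"
    then obtain x c where "x \<in> K" "y = f x" "c \<in> C" "s + x = R *\<^sub>R c" using s unfolding K'_def by blast
    then show "y \<in> C" using R0 by (simp add: f_def)
  qed
  have K': "compact K'" "K' \<noteq> {}" "convex K'"
  proof -
    show "compact K'" unfolding K'_def f_def
      by (intro compact_continuous_image continuous_intros Kp)
    have "K' = (\<lambda>x. (1 / R) *\<^sub>R x) ` ((\<lambda>x. s + x) ` K)" by (auto simp: K'_def f_def)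
    then show "convex K'" using Kp(3) by (simp add: convex_scaling convex_translation)
  qed (use Kp in \<open>auto simp: K'_def\<close>)
  have opt: "1 \<le> l" if l: "0 \<le> l" "(\<lambda>x. v + x) ` K' \<subseteq> (\<lambda>x. l *\<^sub>R x) ` C" for l v
  proof -
    have "(\<lambda>x. (R *\<^sub>R v + s) + x) ` K \<subseteq> (\<lambda>x. (R * l) *\<^sub>R x) ` C"
    proof clarify
      fix x assume "x \<in> K"
      then obtain c where c: "c \<in> C" "v + f x = l *\<^sub>R c" using l(2) unfolding K'_def by blast
      have "R *\<^sub>R v + s + x = R *\<^sub>R (v + f x)" using R0 by (simp add: f_def algebra_simps)
      then show "R *\<^sub>R v + s + x \<in> (\<lambda>x. (R * l) *\<^sub>R x) ` C" using c by auto
    qed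
    then have "R \<le> R * l" using circumradius_least(2)[OF Kp(1,2) C] l(1) R unfolding defs
      by (metis mult_nonneg_nonneg)
    then show ?thesis using R0 by simp
  qed
  have d': "\<exists>c\<in>C. \<exists>c'\<in>C. x - y = (d / R) *\<^sub>R (c - c')" if xy: "x \<in> K'" "y \<in> K'" for x y
  proof -
    obtain a b where ab: "a \<in> K" "b \<in> K" "x = f a" "y = f b" using xy by (auto simp: K'_def)
    let ?l = "circumradius {a, b} C"
    obtain c c' where c: "c \<in> C" "c' \<in> C" "a - b = ?l *\<^sub>R (c - c')" "0 \<le> ?l"
      using circumradius_pair_attained[OF C] .
    show ?thesis
    proof (cases "d = 0")
      case True
      then have "?l = 0" using dp(1)[OF ab(1,2)] c(4) by simp
      then have "a = b" using c(3) by simp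
      then show ?thesis using ab c True by auto
    next
      case False
      then have d1: "d > 0" using d0 by simp
      define k where "k = ?l / d"
      have k: "0 \<le> k" "k \<le> 1" "?l = d * k" using d1 c(4) dp(1)[OF ab(1,2)] by (auto simp: k_def)
      have "(1 - k) *\<^sub>R c' + k *\<^sub>R c \<in> C" using Cp(2) c k by (auto intro: convexD_alt)
      moreover have "x - y = (d / R) *\<^sub>R (((1 - k) *\<^sub>R c' + k *\<^sub>R c) - c')"
      proof -
        have "x - y = (1 / R) *\<^sub>R (a - b)" unfolding ab f_def by (simp add: algebra_simps)
        also have "\<dots> = (1 / R) *\<^sub>R (d * k) *\<^sub>R (c - c')" using c(3) k(3) by simp
        also have "\<dots> = (d / R) *\<^sub>R (((1 - k) *\<^sub>R c' + k *\<^sub>R c) - c')" by (simp add: algebra_simps)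
        finally show ?thesis .
      qed
      ultimately show ?thesis using c(2) by blast
    qed
  qed
  have r': "(r / R) *\<^sub>R c + (1 / R) *\<^sub>R (s - t) \<in> K'" if cC: "c \<in> C" for c
  proof -
    obtain k where k: "k \<in> K" "r *\<^sub>R c = t + k" using t cC by blast
    have "(r / R) *\<^sub>R c + (1 / R) *\<^sub>R (s - t) = (1 / R) *\<^sub>R (r *\<^sub>R c + (s - t))"
      by (simp add: algebra_simps)
    also have "\<dots> = f k" unfolding k(2) f_def by (simp add: algebra_simps)
    finally show ?thesis using k(1) by (simp add: K'_def)
  qed
  have d'0: "0 \<le> d / R" and d'1: "d / R \<le> 1" using d0 dR R0 by auto
  have "\<exists>a1 a2 a3 p1 p2 p3. a1 + a2 + a3 = 0 \<and> (a1 \<noteq> 0 \<or> a2 \<noteq> 0 \<or> a3 \<noteq> 0) \<and>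
    p1 \<in> K' \<and> p2 \<in> K' \<and> p3 \<in> K' \<and> (\<forall>c\<in>C. a1 \<bullet> c \<le> a1 \<bullet> p1) \<and>
    (\<forall>c\<in>C. a2 \<bullet> c \<le> a2 \<bullet> p2) \<and> (\<forall>c\<in>C. a3 \<bullet> c \<le> a3 \<bullet> p3)"
    by (rule optimal_containment_plane[OF K'(1,2) Cp K'C]) (rule opt)
  then obtain a1 a2 a3 p1 p2 p3 where a: "a1 + a2 + a3 = 0" "a1 \<noteq> 0 \<or> a2 \<noteq> 0 \<or> a3 \<noteq> 0"
    and p: "p1 \<in> K'" "p2 \<in> K'" "p3 \<in> K'" and h: "\<forall>c\<in>C. a1 \<bullet> c \<le> a1 \<bullet> p1"
    "\<forall>c\<in>C. a2 \<bullet> c \<le> a2 \<bullet> p2" "\<forall>c\<in>C. a3 \<bullet> c \<le> a3 \<bullet> p3"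
    by (elim exE conjE)
  have 1: "1 + 2 * (r / R) \<le> 3 * (d / R)"
    by (rule inradius_diameter_inequality[OF Cp(1) ball a p K'C _ _ _ r' d' d'0]) (use h in blast)+
  have half: "1 / 2 \<le> d / R"
    by (rule inscribed_copy(1)[OF K'(3) ball a p K'C _ _ _ d' d'0 d'1]) (use h in blast)+
  have "\<exists>m v. d / R * (1 - d / R) \<le> m \<and> 0 \<le> m \<and> (\<forall>c\<in>C. m *\<^sub>R c + v \<in> K')"
    by (rule inscribed_copy(2)[OF K'(3) ball a p K'C _ _ _ d' d'0 d'1]) (use h in blast)+
  then obtain m v where m: "d / R * (1 - d / R) \<le> m" "0 \<le> m" "\<And>c. c \<in> C \<Longrightarrow> m *\<^sub>R c + v \<in> K'"
    by blast
  have "(\<lambda>x. (R * m) *\<^sub>R x) ` C \<subseteq> (\<lambda>x. (s - R *\<^sub>R v) + x) ` K"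
  proof clarify
    fix c assume "c \<in> C"
    then obtain k where k: "k \<in> K" "m *\<^sub>R c + v = f k" using m(3) unfolding K'_def by blast
    then have "R *\<^sub>R (m *\<^sub>R c + v) = s + k" using R0 by (simp add: f_def)
    then have "(R * m) *\<^sub>R c = (s - R *\<^sub>R v) + k" by (simp add: algebra_simps)
    then show "(R * m) *\<^sub>R c \<in> (\<lambda>x. (s - R *\<^sub>R v) + x) ` K" using k(1) by blast
  qed
  then have "R * m \<le> r" using inradius_greatest(2)[OF Kp(1,2) C] R m(2) unfolding defs
    by (metis mult_nonneg_nonneg)
  then have "m \<le> r / R" using R0 by (simp add: field_simps)
  then have "d / R * (1 - d / R) \<le> r / R" using m(1) by linarith
  moreover have "radii_ratios K C = (r / R, d / R)" by (simp add: radii_ratios_def defs)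
  ultimately show ?thesis using 1 half d'1 by (simp add: radii_region_def)
qed

theorem theorem1p3:
  fixes S :: "(real^2) set" and a b c :: "real^2"
  assumes "\<not> collinear {a, b, c}"
    and "S = convex hull {a, b, c}"
  shows "full_diagram TYPE(real^2) = diagram S"
proof
  have S: "convex hull {a, b, c} \<in> gauges" by (rule triangle_is_gauge[OF assms(1)])
  then show "diagram S \<subseteq> full_diagram TYPE(real^2)"
    unfolding full_diagram_def assms(2) by blast
  obtain n1 n2 n3 k1 k2 k3 where "barycentric a b c n1 n2 n3 k1 k2 k3"
    using barycentric_exists[OF assms(1)] by blast
  then interpret barycentric a b c n1 n2 n3 k1 k2 k3 .
  have "full_diagram TYPE(real^2) \<subseteq> radii_region"
    using radii_ratios_in_region unfolding full_diagram_def diagram_def by blast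
  also have "\<dots> \<subseteq> diagram S" unfolding assms(2) by (rule region_subset_diagram[OF S])
  finally show "full_diagram TYPE(real^2) \<subseteq> diagram S" .
qed

end
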